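(* Let $N\ge2$ and let $V,W\colon\mathbb{R}^N\to\mathbb{R}$ be continuous with $\inf_{\mathbb{R}^N}V>0$ and $\inf_{\mathbb{R}^N}W>0$. Suppose there exist a function $\phi\colon\mathbb{R}^N\to\mathbb{R}_+$ with $\phi(x)\to0$ as $|x|\to+\infty$, numbers $\bar\tau>2$, $\tilde R>0$ and a constant $C>0$ such that \[ W(x)\le C\,\phi(x)\,V(x)\,|x|^{\frac{(N-1)(\bar\tau-2)}{2}}\quad\text{whenever }|x|\ge\tilde R . \] Then $H^1_{V,\mathrm{rad}}(\mathbb{R}^N)$ is compactly embedded in $L^\tau_{W,\mathrm{rad}}(\mathbb{R}^N)$ for all $\tau\ge\bar\tau$ if $N=2$, and for all $\bar\tau\le\tau<2^*=\frac{2N}{N-2}$ if $N\ge3$.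
   Context: $H^1_V(\mathbb{R}^N)$ is the completion of $C_0^\infty(\mathbb{R}^N)$ with respect to the norm $\|u\|_V=\left(\int_{\mathbb{R}^N}(|\nabla u|^2+V(x)|u|^2)\,dx\right)^{1/2}$; $L^\tau_W(\mathbb{R}^N)$ is the space of measurable $u$ with $\int_{\mathbb{R}^N}W(x)|u|^\tau dx<+\infty$, normed by $\left(\int W|u|^\tau\right)^{1/\tau}$. $H^1_{V,\mathrm{rad}}(\mathbb{R}^N)$ and $L^\tau_{W,\mathrm{rad}}(\mathbb{R}^N)$ denote the subsets of radially symmetric functions in $H^1_V(\mathbb{R}^N)$ and $L^\tau_W(\mathbb{R}^N)$ respectively. *)

theory Defs
  imports "HOL-Analysis.Analysis"
begin

text \<open>Infinitely differentiable real-valued functions on a Euclidean space: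
  f is differentiable everywhere and all first partial derivatives are again
  infinitely differentiable (greatest fixed point = C-infinity).\<close>
coinductive smooth_fun :: "('a::euclidean_space \<Rightarrow> real) \<Rightarrow> bool" where
  "(\<forall>x. f differentiable (at x)) \<Longrightarrow>
   (\<forall>b\<in>Basis. smooth_fun (\<lambda>x. frechet_derivative f (at x) b)) \<Longrightarrow> smooth_fun f"

definition C0_inf :: "('a::euclidean_space \<Rightarrow> real) set" where
  "C0_inf = {f. smooth_fun f \<and> compact (closure {x. f x \<noteq> 0})}"

definition grad_sq :: "('a::euclidean_space \<Rightarrow> real) \<Rightarrow> 'a \<Rightarrow> real" where
  "grad_sq f x = (\<Sum>b\<in>Basis. (frechet_derivative f (at x) b)\<^sup>2)"

definition normV_sq :: "('a::euclidean_space \<Rightarrow> real) \<Rightarrow> ('a \<Rightarrow> real) \<Rightarrow> ennreal" where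
  "normV_sq V f = (\<integral>\<^sup>+ x. ennreal (grad_sq f x + V x * (f x)\<^sup>2) \<partial>lebesgue)"

text \<open>H^1_V as the completion of C_0^infinity: (representatives of) functions u that
  are L^2 limits of sequences in C_0^infinity which are Cauchy for the V-norm
  (since inf V > 0, the completion embeds into L^2).  An element is bounded by M
  when it admits such an approximating sequence with V-norms at most M.\<close>
definition H1V_approx :: "('a::euclidean_space \<Rightarrow> real) \<Rightarrow> ('a \<Rightarrow> real) \<Rightarrow> (nat \<Rightarrow> 'a \<Rightarrow> real) \<Rightarrow> bool" where
  "H1V_approx V u \<phi> \<longleftrightarrow>
     (\<forall>k. \<phi> k \<in> C0_inf) \<and>
     (\<forall>e>0. \<exists>K. \<forall>m\<ge>K. \<forall>n\<ge>K. normV_sq V (\<lambda>x. \<phi> m x - \<phi> n x) < ennreal e) \<and>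
     ((\<lambda>k. \<integral>\<^sup>+ x. ennreal ((\<phi> k x - u x)\<^sup>2) \<partial>lebesgue) \<longlonglongrightarrow> 0)"

definition H1V :: "('a::euclidean_space \<Rightarrow> real) \<Rightarrow> ('a \<Rightarrow> real) set" where
  "H1V V = {u. u \<in> borel_measurable lebesgue \<and> (\<exists>\<phi>. H1V_approx V u \<phi>)}"

definition H1V_bounded_by :: "('a::euclidean_space \<Rightarrow> real) \<Rightarrow> real \<Rightarrow> ('a \<Rightarrow> real) \<Rightarrow> bool" where
  "H1V_bounded_by V M u \<longleftrightarrow> u \<in> borel_measurable lebesgue \<and>
     (\<exists>\<phi>. H1V_approx V u \<phi> \<and> (\<forall>k. normV_sq V (\<phi> k) \<le> ennreal (M\<^sup>2)))"

definition LW :: "('a::euclidean_space \<Rightarrow> real) \<Rightarrow> real \<Rightarrow> ('a \<Rightarrow> real) set" where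
  "LW W \<tau> = {u. u \<in> borel_measurable lebesgue \<and>
              (\<integral>\<^sup>+ x. ennreal (W x * \<bar>u x\<bar> powr \<tau>) \<partial>lebesgue) < \<infinity>}"

definition radial :: "('a::euclidean_space \<Rightarrow> real) \<Rightarrow> bool" where
  "radial u \<longleftrightarrow> (\<forall>x y. norm x = norm y \<longrightarrow> u x = u y)"

definition H1V_rad :: "('a::euclidean_space \<Rightarrow> real) \<Rightarrow> ('a \<Rightarrow> real) set" where "H1V_rad V = {u \<in> H1V V. radial u}"
definition LW_rad :: "('a::euclidean_space \<Rightarrow> real) \<Rightarrow> real \<Rightarrow> ('a \<Rightarrow> real) set" where "LW_rad W \<tau> = {u \<in> LW W \<tau>. radial u}"

definition compact_embedding_rad ::
  "('a::euclidean_space \<Rightarrow> real) \<Rightarrow> ('a \<Rightarrow> real) \<Rightarrow> real \<Rightarrow> bool" where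
  "compact_embedding_rad V W \<tau> \<longleftrightarrow>
     H1V_rad V \<subseteq> LW_rad W \<tau> \<and>
     (\<forall>(u::nat \<Rightarrow> 'a \<Rightarrow> real) M. (\<forall>n. u n \<in> H1V_rad V \<and> H1V_bounded_by V M (u n)) \<longrightarrow>
        (\<exists>r v. strict_mono r \<and> v \<in> LW_rad W \<tau> \<and>
           ((\<lambda>n. \<integral>\<^sup>+ x. ennreal (W x * \<bar>u (r n) x - v x\<bar> powr \<tau>) \<partial>lebesgue) \<longlonglongrightarrow> 0)))"

end

theory Submission
  imports Defs "HOL-Complex_Analysis.Great_Picard" "HOL-Probability.Probability_Measure"
begin

text \<open>
  Along a ray, a compactly supported \<open>C\<^sup>1\<close> function \<open>f\<close> becomes a function \<open>g\<close> of one variable,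
  and the weighted energy \<open>\<integral> t\<^sup>n (g'\<^sup>2 + g\<^sup>2)\<close>, \<open>n = N - 1\<close>, bounds \<open>r\<^sup>n g(r)\<^sup>2\<close> for every \<open>r\<close>
  (Strauss' estimate), \<open>r powr (2 * \<alpha>) * g(r)\<^sup>2\<close> for \<open>r \<le> 1\<close> and any \<open>\<alpha> > 0\<close> with \<open>2 * \<alpha> \<ge> N - 2\<close>,
  and the square of the Hoelder quotient of \<open>g\<close> of exponent \<open>1/2\<close> away from \<open>0\<close>. Averaging over the
  sphere, the spherical means of \<open>f\<close> obey the same bounds in terms of the \<open>H\<^sup>1\<close> norm of \<open>f\<close>. Since
  taking spherical means contracts \<open>L\<^sup>2\<close> and fixes radial functions, a radial element of the space
  is the limit of the spherical means of its approximations, which need not be radial, and inherits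
  these bounds. A bounded sequence of profiles is thus equicontinuous and subconverges pointwise. As
  \<open>\<tau>\<close> is subcritical, some \<open>\<alpha>\<close> satisfies \<open>\<alpha> * \<tau> < N\<close>, so dominated convergence applies on balls; outside
  large balls the decay of the profiles and the hypothesis on \<open>W\<close> bound the \<open>W\<close>-integral by a small
  multiple of the \<open>V\<close>-integral.
\<close>

section \<open>Preliminaries from measure theory\<close>

lemma borel_measure_eqI_atMost:
  fixes M N :: "real measure"
  assumes sets: "sets M = sets borel" "sets N = sets borel"
    and eq: "\<And>r. emeasure M {..r} = emeasure N {..r}" and fin: "\<And>r. emeasure M {..r} \<noteq> \<infinity>"
  shows "M = N"
proof (rule measure_eqI_generator_eq[where E = "range atMost" and \<Omega> = UNIV and A = "\<lambda>n. {..real n}"])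
  show "Int_stable (range (atMost :: real \<Rightarrow> _))" by (auto simp: Int_stable_def)
  show "sets M = sigma_sets UNIV (range atMost)" "sets N = sigma_sets UNIV (range atMost)"
    using sets by (simp_all add: borel_eq_atMost)
  show "(\<Union>n. {..real n}) = UNIV" using real_arch_simple by auto
qed (use eq fin in auto)

lemma ennreal_le_double_sum:
  assumes "x \<le> 2 * y + 2 * z" "0 \<le> y" "0 \<le> z"
  shows "ennreal x \<le> 2 * ennreal y + 2 * ennreal z"
proof -
  have "2 * ennreal y + 2 * ennreal z = ennreal (2 * y + 2 * z)"
    using assms(2,3) by (simp add: ennreal_mult')
  then show ?thesis using ennreal_leI[OF assms(1)] by simp
qed

lemma ennreal_tendsto_0I:
  fixes f :: "nat \<Rightarrow> ennreal"
  assumes "\<And>e. 0 < e \<Longrightarrow> \<forall>\<^sub>F k in sequentially. f k \<le> ennreal e"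
  shows "f \<longlonglongrightarrow> 0"
proof (rule order_tendstoI)
  fix a :: ennreal assume "0 < a"
  then obtain b where b: "0 < b" "b < a" using dense by blast
  then obtain e where e: "b = ennreal e" "0 < e" by (cases b) auto
  show "\<forall>\<^sub>F k in sequentially. f k < a"
    using assms[OF e(2)] by eventually_elim (use b(2) e(1) in auto)
qed simp

lemma abs_diff_le_nn_integral_deriv:
  fixes g g' :: "real \<Rightarrow> real"
  assumes "a \<le> b"
    and "\<And>t. a \<le> t \<Longrightarrow> t \<le> b \<Longrightarrow> (g has_real_derivative g' t) (at t)"
    and "\<And>t. a \<le> t \<Longrightarrow> t \<le> b \<Longrightarrow> isCont g' t"
  shows "ennreal \<bar>g b - g a\<bar> \<le> (\<integral>\<^sup>+t\<in>{a..b}. ennreal \<bar>g' t\<bar> \<partial>lborel)"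
proof -
  have "has_bochner_integral lborel (\<lambda>t. g' t * indicator {a..b} t) (g b - g a)"
    using assms by (intro has_bochner_integral_FTC_Icc_real)
  from has_bochner_integral_norm_bound[OF this]
  have "ennreal \<bar>g b - g a\<bar> \<le> (\<integral>\<^sup>+t. ennreal \<bar>g' t * indicator {a..b} t\<bar> \<partial>lborel)" by simp
  also have "\<dots> = (\<integral>\<^sup>+t\<in>{a..b}. ennreal \<bar>g' t\<bar> \<partial>lborel)"
    by (intro nn_integral_cong) (simp add: indicator_def)
  finally show ?thesis .
qed

lemma (in prob_space) expectation_power2_le_nn_integral:
  assumes [measurable]: "X \<in> borel_measurable M"
  shows "ennreal ((expectation X)\<^sup>2) \<le> (\<integral>\<^sup>+x. ennreal ((X x)\<^sup>2) \<partial>M)"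
proof (cases "integrable M X")
  case True
  have "ennreal ((expectation X)\<^sup>2) = (ennreal \<bar>expectation X\<bar>)\<^sup>2" by (simp add: ennreal_power)
  also have "\<dots> \<le> (\<integral>\<^sup>+x. ennreal \<bar>X x\<bar> * 1 \<partial>M)\<^sup>2"
    using integral_norm_bound_ennreal[OF True] by (simp add: power_mono_ennreal)
  also have "\<dots> \<le> (\<integral>\<^sup>+x. (ennreal \<bar>X x\<bar>)\<^sup>2 \<partial>M) * (\<integral>\<^sup>+x. 1\<^sup>2 \<partial>M)"
    by (rule Cauchy_Schwarz_nn_integral) measurable
  finally show ?thesis by (simp add: ennreal_power emeasure_space_1)
qed (simp add: not_integrable_integral_eq)

lemma nn_integral_AE_LIMSEQ_le:
  fixes g :: "nat \<Rightarrow> 'b \<Rightarrow> ennreal"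
  assumes [measurable]: "\<And>k. g k \<in> borel_measurable M"
    and lim: "AE x in M. (\<lambda>k. g k x) \<longlonglongrightarrow> h x"
    and bound: "\<And>k. (\<integral>\<^sup>+x. g k x \<partial>M) \<le> b k" "b \<longlonglongrightarrow> e"
  shows "(\<integral>\<^sup>+x. h x \<partial>M) \<le> e"
proof -
  have "AE x in M. h x = liminf (\<lambda>k. g k x)"
    using lim by eventually_elim (simp add: lim_imp_Liminf)
  then have "(\<integral>\<^sup>+x. h x \<partial>M) = (\<integral>\<^sup>+x. liminf (\<lambda>k. g k x) \<partial>M)" by (rule nn_integral_cong_AE)
  also have "\<dots> \<le> liminf (\<lambda>k. \<integral>\<^sup>+x. g k x \<partial>M)" by (rule nn_integral_liminf) measurable
  also have "\<dots> \<le> liminf b" using bound(1) by (intro Liminf_mono always_eventually allI)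
  also have "\<dots> = e" using bound(2) by (simp add: lim_imp_Liminf)
  finally show ?thesis .
qed

lemma nn_integral_tendsto_0_AE_subseq:
  fixes g :: "nat \<Rightarrow> 'b \<Rightarrow> real"
  assumes [measurable]: "\<And>k. g k \<in> borel_measurable M" and nonneg: "\<And>k x. 0 \<le> g k x"
    and lim: "(\<lambda>k. \<integral>\<^sup>+x. ennreal (g k x) \<partial>M) \<longlonglongrightarrow> 0"
  obtains \<sigma> :: "nat \<Rightarrow> nat" where "strict_mono \<sigma>" "AE x in M. (\<lambda>k. g (\<sigma> k) x) \<longlonglongrightarrow> 0"
proof -
  have "\<forall>\<^sub>F k in sequentially. (\<integral>\<^sup>+x. ennreal (g k x) \<partial>M) < \<infinity>"
    using order_tendstoD(2)[OF lim, of \<infinity>] by simp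
  then obtain K where "\<And>k. K \<le> k \<Longrightarrow> (\<integral>\<^sup>+x. ennreal (g k x) \<partial>M) < \<infinity>"
    unfolding eventually_sequentially by blast
  then have int: "integrable M (g (k + K))" for k
    using nonneg by (intro integrableI_nonneg) auto
  have "(\<lambda>k. enn2real (\<integral>\<^sup>+x. ennreal (g (k + K) x) \<partial>M)) \<longlonglongrightarrow> 0"
    using tendsto_enn2real[of _ 0] LIMSEQ_ignore_initial_segment[OF lim, of K] by simp
  then have "(\<lambda>k. \<integral>x. norm (g (k + K) x) \<partial>M) \<longlonglongrightarrow> 0"
    using nonneg by (simp add: integral_eq_nn_integral)
  then obtain \<sigma> :: "nat \<Rightarrow> nat"
    where "strict_mono \<sigma>" "AE x in M. (\<lambda>k. g (\<sigma> k + K) x) \<longlonglongrightarrow> 0"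
    using tendsto_L1_AE_subseq[of M "\<lambda>k. g (k + K)", OF int] by blast
  then show ?thesis by (intro that[of "\<lambda>k. \<sigma> k + K"]) (simp_all add: strict_mono_def)
qed

definition weighted_L2_sq :: "('a::euclidean_space \<Rightarrow> real) \<Rightarrow> ('a \<Rightarrow> real) \<Rightarrow> ennreal" where
  "weighted_L2_sq V w = (\<integral>\<^sup>+x. ennreal (V x * (w x)\<^sup>2) \<partial>lebesgue)"

lemma weighted_L2_sq_AE_LIMSEQ_le:
  assumes [measurable]: "V \<in> borel_measurable lebesgue" "\<And>k. w k \<in> borel_measurable lebesgue"
    and lim: "AE x in lebesgue. (\<lambda>k. w k x) \<longlonglongrightarrow> v x" and e: "\<And>k. weighted_L2_sq V (w k) \<le> e"
  shows "weighted_L2_sq V v \<le> e"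
  unfolding weighted_L2_sq_def
proof (rule nn_integral_AE_LIMSEQ_le)
  show "AE x in lebesgue. (\<lambda>k. ennreal (V x * (w k x)\<^sup>2)) \<longlonglongrightarrow> ennreal (V x * (v x)\<^sup>2)"
    using lim by eventually_elim (intro tendsto_ennrealI tendsto_mult_left tendsto_power)
  show "(\<integral>\<^sup>+x. ennreal (V x * (w k x)\<^sup>2) \<partial>lebesgue) \<le> e" for k
    using e by (simp add: weighted_L2_sq_def)
qed auto

lemma weighted_L2_sq_diff_le:
  assumes [measurable]: "V \<in> borel_measurable lebesgue"
      "w \<in> borel_measurable lebesgue" "v \<in> borel_measurable lebesgue"
    and V: "\<And>x. 0 \<le> V x"
  shows "weighted_L2_sq V (\<lambda>x. w x - v x) \<le> 2 * weighted_L2_sq V w + 2 * weighted_L2_sq V v"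
proof -
  have "V x * (w x - v x)\<^sup>2 \<le> 2 * (V x * (w x)\<^sup>2) + 2 * (V x * (v x)\<^sup>2)" for x
    using mult_nonneg_nonneg[OF V zero_le_power2[of "w x + v x"], of x]
    by (simp add: power2_eq_square algebra_simps)
  then have "weighted_L2_sq V (\<lambda>x. w x - v x)
      \<le> (\<integral>\<^sup>+x. 2 * ennreal (V x * (w x)\<^sup>2) + 2 * ennreal (V x * (v x)\<^sup>2) \<partial>lebesgue)"
    unfolding weighted_L2_sq_def by (intro nn_integral_mono ennreal_le_double_sum) (auto simp: V)
  also have "\<dots> = 2 * weighted_L2_sq V w + 2 * weighted_L2_sq V v"
    by (simp add: weighted_L2_sq_def nn_integral_add nn_integral_cmult)
  finally show ?thesis .
qed

section \<open>Polar coordinates\<close>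

definition uniform_sphere :: "'a::euclidean_space measure" where
  "uniform_sphere = distr (uniform_measure lborel (cball 0 1)) borel sgn"

definition radial_measure :: "'a::euclidean_space itself \<Rightarrow> real measure" where
  "radial_measure _ = distr (lborel :: 'a measure) borel norm"

definition sphere_area :: "'a::euclidean_space itself \<Rightarrow> real" where
  "sphere_area _ = real DIM('a) * unit_ball_vol (real DIM('a))"

lemma sphere_area_pos: "0 < sphere_area TYPE('a::euclidean_space)"
  by (simp add: sphere_area_def)

lemma sets_uniform_sphere [simp, measurable_cong]: "sets uniform_sphere = sets borel"
  by (simp add: uniform_sphere_def)

lemma space_uniform_sphere [simp]: "space uniform_sphere = UNIV"
  by (simp add: uniform_sphere_def)

lemma sets_radial_measure [simp, measurable_cong]:
  "sets (radial_measure TYPE('a::euclidean_space)) = sets borel"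
  by (simp add: radial_measure_def)

interpretation uniform_sphere: prob_space "uniform_sphere :: 'a::euclidean_space measure"
  unfolding uniform_sphere_def
  by (intro prob_space.prob_space_distr prob_space_uniform_measure)
    (auto simp: emeasure_cball ennreal_eq_0_iff not_le)

lemma AE_uniform_sphere_norm: "AE \<omega> in (uniform_sphere :: 'a::euclidean_space measure). norm \<omega> = 1"
proof -
  have "AE x in uniform_measure lborel (cball (0::'a) 1). norm (sgn x) = 1"
    using AE_lborel_singleton[of "0::'a"]
    by (intro AE_uniform_measureI) (auto simp: norm_sgn elim: eventually_mono)
  then show ?thesis
    unfolding uniform_sphere_def by (subst AE_distr_iff) measurable
qed

lemma emeasure_lborel_cone:
  fixes B :: "'a::euclidean_space set"
  assumes [measurable]: "B \<in> sets borel"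
  shows "emeasure lborel {x. norm x \<le> r \<and> sgn x \<in> B}
    = emeasure lborel (cball (0::'a) r) * emeasure uniform_sphere B"
proof (cases "0 < r")
  case True
  let ?K = "{x::'a. norm x \<le> 1 \<and> sgn x \<in> B}"
  have "x \<in> (\<lambda>x. r *\<^sub>R x + 0) ` ?K" if "norm x \<le> r" "sgn x \<in> B" for x
    using that True by (intro image_eqI[of _ _ "x /\<^sub>R r"]) (auto simp: sgn_scaleR divide_simps)
  then have "{x. norm x \<le> r \<and> sgn x \<in> B} = (\<lambda>x. r *\<^sub>R x + 0) ` ?K"
    using True by (auto simp: sgn_scaleR mult_left_le)
  then have "emeasure lebesgue {x. norm x \<le> r \<and> sgn x \<in> B}
      = ennreal (r ^ DIM('a)) * emeasure lebesgue ?K"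
    using True by (simp only: emeasure_lebesgue_affine abs_of_pos ennreal_power)
  then have scale: "emeasure lborel {x. norm x \<le> r \<and> sgn x \<in> B}
      = ennreal (r ^ DIM('a)) * emeasure lborel ?K" by simp
  have "emeasure uniform_sphere B
      = emeasure (uniform_measure lborel (cball (0::'a) 1)) (sgn -` B)"
    by (simp add: uniform_sphere_def emeasure_distr)
  also have "\<dots> = emeasure lborel (cball 0 1 \<inter> sgn -` B) / emeasure lborel (cball (0::'a) 1)"
    using measurable_sets_borel[OF borel_measurable_sgn assms] by (intro emeasure_uniform_measure) auto
  also have "cball 0 1 \<inter> sgn -` B = ?K" by auto
  finally have "emeasure lborel (cball (0::'a) 1) * emeasure uniform_sphere B = emeasure lborel ?K"
    by (simp add: emeasure_cball ennreal_times_divide ennreal_mult_divide_eq mult.commute[of "ennreal _"]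
        ennreal_eq_0_iff not_le)
  from this[symmetric] show ?thesis
    unfolding scale using True by (simp add: emeasure_cball ennreal_mult mult_ac)
next
  case False
  then have "x = 0" if "norm x \<le> r" for x :: 'a
    using that by (simp flip: norm_le_zero_iff)
  then have "{x. norm x \<le> r \<and> sgn x \<in> B} \<subseteq> {0}" "cball (0::'a) r \<subseteq> {0}" by auto
  moreover have "emeasure lborel X = 0" if "X \<subseteq> {0}" for X :: "'a set"
    using emeasure_mono[OF that, of lborel] by simp
  ultimately show ?thesis by simp
qed

lemma emeasure_radial_measure_atMost:
  "emeasure (radial_measure TYPE('a::euclidean_space)) {..r} = emeasure lborel (cball (0::'a) r)"
  by (simp add: radial_measure_def emeasure_distr vimage_def cball_def)

lemma radial_measure_eq_density:
  "radial_measure TYPE('a::euclidean_space) =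
    density lborel (\<lambda>t. ennreal (indicator {0..} t * (sphere_area TYPE('a) * t ^ (DIM('a) - 1))))"
  (is "_ = ?N")
proof (rule borel_measure_eqI_atMost)
  fix r :: real
  let ?v = "unit_ball_vol (real DIM('a))"
  let ?I = "\<integral>\<^sup>+t\<in>{0..r}. ennreal (sphere_area TYPE('a) * t ^ (DIM('a) - 1)) \<partial>lborel"
  have "emeasure ?N {..r} = ?I"
    by (subst emeasure_density; (rule nn_integral_cong)?) (auto simp: indicator_def)
  moreover have "?I = ennreal (?v * r ^ DIM('a) - ?v * 0 ^ DIM('a))" if "0 \<le> r"
    using that by (intro nn_integral_FTC_Icc)
      (auto intro!: derivative_eq_intros mult_nonneg_nonneg simp: sphere_area_def)
  ultimately show "emeasure (radial_measure TYPE('a)) {..r} = emeasure ?N {..r}"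
    by (cases "r < 0") (auto simp: emeasure_radial_measure_atMost emeasure_cball power_0_left)
  show "emeasure (radial_measure TYPE('a)) {..r} \<noteq> \<infinity>"
    using emeasure_lborel_cball_finite[of "0::'a" r] by (simp add: emeasure_radial_measure_atMost)
qed simp_all

interpretation radial_measure: sigma_finite_measure "radial_measure TYPE('a::euclidean_space)"
  unfolding radial_measure_eq_density
  by (subst sigma_finite_measure.sigma_finite_iff_density_finite[OF sigma_finite_lborel]) auto

lemma emeasure_lborel_norm_sgn:
  fixes B :: "'a::euclidean_space set"
  assumes [measurable]: "A \<in> sets borel" "B \<in> sets borel"
  shows "emeasure lborel {x. norm x \<in> A \<and> sgn x \<in> B}
    = emeasure (radial_measure TYPE('a)) A * emeasure uniform_sphere B"
proof -
  let ?M = "distr (density lborel (indicator (sgn -` B))) borel (norm :: 'a \<Rightarrow> real)"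
  let ?N = "scale_measure (emeasure uniform_sphere B) (radial_measure TYPE('a))"
  have [measurable]: "sgn -` B \<in> sets (borel :: 'a measure)"
    by (rule measurable_sets_borel[OF borel_measurable_sgn]) simp
  have emeasure_M: "emeasure ?M C = emeasure lborel {x. norm x \<in> C \<and> sgn x \<in> B}"
    if [measurable]: "C \<in> sets borel" for C
  proof -
    have "emeasure ?M C = (\<integral>\<^sup>+x. indicator {x. norm x \<in> C \<and> sgn x \<in> B} x \<partial>lborel)"
      by (simp add: emeasure_distr emeasure_density vimage_def del: nn_integral_indicator)
        (auto intro!: nn_integral_cong simp: indicator_def)
    then show ?thesis by simp
  qed
  have "?M = ?N"
  proof (rule borel_measure_eqI_atMost)
    fix r
    show "emeasure ?M {..r} = emeasure ?N {..r}"
      by (simp add: emeasure_M emeasure_lborel_cone emeasure_radial_measure_atMost mult.commute)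
    have "emeasure lborel {x::'a. norm x \<le> r \<and> sgn x \<in> B} \<le> emeasure lborel (cball (0::'a) r)"
      by (intro emeasure_mono) auto
    then show "emeasure ?M {..r} \<noteq> \<infinity>"
      using emeasure_lborel_cball_finite[of "0::'a" r] by (auto simp: emeasure_M top_unique)
  qed simp_all
  then have "emeasure ?M A = emeasure ?N A" by (rule arg_cong)
  then show ?thesis by (simp add: emeasure_M mult.commute)
qed

lemma distr_norm_sgn_lborel:
  "distr (lborel :: 'a::euclidean_space measure) (borel \<Otimes>\<^sub>M borel) (\<lambda>x. (norm x, sgn x))
    = radial_measure TYPE('a) \<Otimes>\<^sub>M uniform_sphere"
proof (rule pair_measure_eqI[symmetric])
  fix A :: "real set" and B :: "'a set"
  assume "A \<in> sets (radial_measure TYPE('a))" "B \<in> sets uniform_sphere"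
  then have [measurable]: "A \<in> sets borel" "B \<in> sets borel" by simp_all
  show "emeasure (radial_measure TYPE('a)) A * emeasure uniform_sphere B
    = emeasure (distr lborel (borel \<Otimes>\<^sub>M borel) (\<lambda>x::'a. (norm x, sgn x))) (A \<times> B)"
    by (simp add: emeasure_distr vimage_def emeasure_lborel_norm_sgn)
qed (simp_all add: radial_measure.sigma_finite_measure_axioms uniform_sphere.sigma_finite_measure_axioms
    cong: sets_pair_measure_cong)

interpretation polar: pair_sigma_finite
  "radial_measure TYPE('a::euclidean_space)" "uniform_sphere :: 'a measure" ..

lemma lborel_eq_distr_polar:
  "(lborel :: 'a::euclidean_space measure)
    = distr (radial_measure TYPE('a) \<Otimes>\<^sub>M uniform_sphere) borel (\<lambda>(t, \<omega>). t *\<^sub>R \<omega>)"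
proof -
  have "norm x *\<^sub>R sgn x = x" for x :: 'a by (cases "x = 0") (simp_all add: sgn_div_norm)
  then show ?thesis
    by (simp add: distr_distr distr_id2 comp_def flip: distr_norm_sgn_lborel)
qed

lemma AE_lborel_polar:
  assumes "AE x in lborel. P (x::'a::euclidean_space)"
  shows "AE t in radial_measure TYPE('a). AE \<omega> in uniform_sphere. P (t *\<^sub>R \<omega>)"
proof -
  have "AE z in radial_measure TYPE('a) \<Otimes>\<^sub>M uniform_sphere. P (case z of (t, \<omega>) \<Rightarrow> t *\<^sub>R \<omega>)"
    using assms unfolding lborel_eq_distr_polar by (rule AE_distrD[rotated]) measurable
  from polar.AE_pair[OF this] show ?thesis by simp
qed

lemma
  fixes f :: "'a::euclidean_space \<Rightarrow> ennreal"
  assumes [measurable]: "f \<in> borel_measurable borel"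
  shows nn_integral_polar:
      "(\<integral>\<^sup>+x. f x \<partial>lborel) = (\<integral>\<^sup>+t. \<integral>\<^sup>+\<omega>. f (t *\<^sub>R \<omega>) \<partial>uniform_sphere \<partial>radial_measure TYPE('a))"
    and nn_integral_polar_rays:
      "(\<integral>\<^sup>+x. f x \<partial>lborel) = (\<integral>\<^sup>+\<omega>. \<integral>\<^sup>+t. f (t *\<^sub>R \<omega>) \<partial>radial_measure TYPE('a) \<partial>uniform_sphere)"
proof -
  have "(\<integral>\<^sup>+x. f x \<partial>lborel)
      = (\<integral>\<^sup>+z. f (fst z *\<^sub>R snd z) \<partial>(radial_measure TYPE('a) \<Otimes>\<^sub>M uniform_sphere))"
    by (subst lborel_eq_distr_polar) (simp add: nn_integral_distr case_prod_beta)
  moreover have "(\<lambda>z. f (fst z *\<^sub>R snd z)) \<in> borel_measurable (radial_measure TYPE('a) \<Otimes>\<^sub>M uniform_sphere)"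
    by measurable
  ultimately show "(\<integral>\<^sup>+x. f x \<partial>lborel) = (\<integral>\<^sup>+t. \<integral>\<^sup>+\<omega>. f (t *\<^sub>R \<omega>) \<partial>uniform_sphere \<partial>radial_measure TYPE('a))"
    and "(\<integral>\<^sup>+x. f x \<partial>lborel) = (\<integral>\<^sup>+\<omega>. \<integral>\<^sup>+t. f (t *\<^sub>R \<omega>) \<partial>radial_measure TYPE('a) \<partial>uniform_sphere)"
    using uniform_sphere.nn_integral_fst[of "\<lambda>z. f (fst z *\<^sub>R snd z)" "radial_measure TYPE('a)"]
      polar.nn_integral_snd[of "\<lambda>z. f (fst z *\<^sub>R snd z)"] by simp_all
qed

lemma nn_integral_radial_measure:
  fixes h :: "real \<Rightarrow> ennreal"
  assumes [measurable]: "h \<in> borel_measurable borel"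
  shows "(\<integral>\<^sup>+t. h t \<partial>radial_measure TYPE('a::euclidean_space))
    = ennreal (sphere_area TYPE('a)) * (\<integral>\<^sup>+t\<in>{0..}. ennreal (t ^ (DIM('a) - 1)) * h t \<partial>lborel)"
proof -
  have "(\<integral>\<^sup>+t. h t \<partial>radial_measure TYPE('a)) = (\<integral>\<^sup>+t. ennreal (sphere_area TYPE('a))
      * (ennreal (t ^ (DIM('a) - 1)) * h t * indicator {0..} t) \<partial>lborel)"
    unfolding radial_measure_eq_density using sphere_area_pos[where 'a = 'a]
    by (subst nn_integral_density; (intro nn_integral_cong)?)
      (auto simp: indicator_def ennreal_mult' mult_ac)
  also have "\<dots> = ennreal (sphere_area TYPE('a)) * (\<integral>\<^sup>+t\<in>{0..}. ennreal (t ^ (DIM('a) - 1)) * h t \<partial>lborel)"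
    by (rule nn_integral_cmult) measurable
  finally show ?thesis .
qed

text \<open>The restriction of \<open>u\<close> to a ray need not be measurable, hence the profile is obtained by
  averaging a Borel representative of \<open>u\<close> over spheres.\<close>
lemma radial_AE_eq_borel_profile:
  fixes u :: "'a::euclidean_space \<Rightarrow> real"
  assumes u: "radial u" "u \<in> borel_measurable lebesgue"
  obtains U where "U \<in> borel_measurable borel" "AE x in lebesgue. u x = U (norm x)"
proof -
  obtain u' where u'[measurable]: "u' \<in> borel_measurable borel" and AE: "AE x in lborel. u x = u' x"
    using completion_ex_borel_measurable_real[OF u(2)] by auto
  define U where "U = (\<lambda>t. \<integral>\<omega>. u' (t *\<^sub>R \<omega>) \<partial>uniform_sphere)"
  have [measurable]: "U \<in> borel_measurable borel" unfolding U_def by measurable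
  obtain b :: 'a where b: "norm b = 1" using norm_Basis nonempty_Basis by blast
  have profile: "u (t *\<^sub>R b) = u x" if "norm x = \<bar>t\<bar>" for t x
    using u(1) that b unfolding radial_def by simp
  have "AE t in radial_measure TYPE('a). U t = u (t *\<^sub>R b)"
    using AE_lborel_polar[OF AE]
  proof eventually_elim
    case (elim t)
    with AE_uniform_sphere_norm have "AE \<omega> in uniform_sphere. u' (t *\<^sub>R \<omega>) = u (t *\<^sub>R b)"
      by eventually_elim (use profile in \<open>metis norm_scaleR mult.right_neutral\<close>)
    then have "U t = (\<integral>\<omega>. u (t *\<^sub>R b) \<partial>(uniform_sphere :: 'a measure))"
      unfolding U_def by (intro integral_cong_AE) auto
    then show ?case by (simp add: uniform_sphere.prob_space[simplified])
  qed
  then have "AE x in lborel. U (norm (x::'a)) = u (norm x *\<^sub>R b)"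
    unfolding radial_measure_def by (rule AE_distrD[rotated]) measurable
  then have "AE x in lebesgue. u x = U (norm x)"
    by (intro AE_completion) (auto simp: profile elim: eventually_mono)
  with \<open>U \<in> borel_measurable borel\<close> show ?thesis by (rule that)
qed

section \<open>Weighted estimates on the half-line\<close>

definition envelope :: "nat \<Rightarrow> real \<Rightarrow> real \<Rightarrow> real" where
  "envelope n \<alpha> r = (if r \<le> 1 then r powr (- \<alpha>) else r powr (- real n / 2))"

lemma envelope_nonneg: "0 \<le> envelope n \<alpha> r"
  by (simp add: envelope_def)

lemma envelope_borel_measurable [measurable]: "envelope n \<alpha> \<in> borel_measurable borel"
  unfolding envelope_def[abs_def] by measurable

lemma envelope_power2:
  assumes "0 < r"
  shows "(envelope n \<alpha> r)\<^sup>2 = (if r \<le> 1 then r powr (- 2 * \<alpha>) else 1 / r ^ n)"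
proof -
  have "(r powr x)\<^sup>2 = r powr (2 * x)" for x
    by (simp add: power2_eq_square powr_add[symmetric])
  moreover have "r powr (- real n) = 1 / r ^ n"
    using assms by (simp add: powr_minus powr_realpow divide_inverse)
  ultimately show ?thesis by (simp add: envelope_def)
qed

lemma nn_integral_inverse_power_le:
  fixes r s :: real
  assumes r: "0 < r" "r \<le> s"
  shows "(\<integral>\<^sup>+t\<in>{r..s}. ennreal (1 / t ^ n) \<partial>lborel) \<le> ennreal ((s - r) / r ^ n)"
proof -
  have "(\<integral>\<^sup>+t\<in>{r..s}. ennreal (1 / t ^ n) \<partial>lborel) \<le> (\<integral>\<^sup>+t\<in>{r..s}. ennreal (1 / r ^ n) \<partial>lborel)"
    using r by (intro nn_integral_mono)
      (auto simp: indicator_def intro!: ennreal_leI divide_left_mono power_mono)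
  also have "\<dots> = ennreal ((s - r) / r ^ n)"
    using r by (simp add: nn_integral_cmult_indicator flip: ennreal_mult)
  finally show ?thesis .
qed

lemma nn_integral_inverse_power_le_powr:
  fixes r :: real
  assumes \<alpha>: "0 < \<alpha>" "real n - 1 \<le> 2 * \<alpha>" and r: "0 < r" "r \<le> 1"
  shows "(\<integral>\<^sup>+t\<in>{r..1}. ennreal (1 / t ^ n) \<partial>lborel) \<le> ennreal (r powr (- 2 * \<alpha>) / (2 * \<alpha>))"
proof -
  have "(\<integral>\<^sup>+t\<in>{r..1}. ennreal (1 / t ^ n) \<partial>lborel)
      \<le> (\<integral>\<^sup>+t\<in>{r..1}. ennreal (t powr (- 2 * \<alpha> - 1)) \<partial>lborel)"
  proof (rule nn_integral_mono)
    fix t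
    have "1 / t ^ n = t powr (- real n)" if "r \<le> t"
      using that r by (simp add: powr_minus powr_realpow divide_inverse)
    moreover have "t powr (- real n) \<le> t powr (- 2 * \<alpha> - 1)" if "r \<le> t" "t \<le> 1"
      using that r \<alpha> by (intro powr_mono') auto
    ultimately show "ennreal (1 / t ^ n) * indicator {r..1} t
        \<le> ennreal (t powr (- 2 * \<alpha> - 1)) * indicator {r..1} t"
      by (auto simp: indicator_def intro: ennreal_leI)
  qed
  also have "\<dots> = ennreal (- (1 powr (- 2 * \<alpha>)) / (2 * \<alpha>) - - (r powr (- 2 * \<alpha>)) / (2 * \<alpha>))"
    using r \<alpha> by (intro nn_integral_FTC_Icc) (auto intro!: derivative_eq_intros)
  also have "\<dots> \<le> ennreal (r powr (- 2 * \<alpha>) / (2 * \<alpha>))"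
    using \<alpha> by (intro ennreal_leI) (simp add: diff_divide_distrib)
  finally show ?thesis .
qed

definition weighted_energy :: "nat \<Rightarrow> (real \<Rightarrow> real) \<Rightarrow> (real \<Rightarrow> real) \<Rightarrow> ennreal" where
  "weighted_energy n g g' = (\<integral>\<^sup>+t\<in>{0..}. ennreal (t ^ n * ((g' t)\<^sup>2 + (g t)\<^sup>2)) \<partial>lborel)"

context
  fixes g g' :: "real \<Rightarrow> real" and n :: nat
  assumes deriv: "\<And>t. (g has_real_derivative g' t) (at t)" and cont_deriv: "continuous_on UNIV g'"
begin

lemma deriv_borel_measurable [measurable]: "g' \<in> borel_measurable borel"
  using cont_deriv by (rule borel_measurable_continuous_onI)

lemma diff_power2_le_inverse_weight_energy:
  assumes r: "0 < r" "r \<le> s"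
  shows "ennreal ((g s - g r)\<^sup>2)
    \<le> (\<integral>\<^sup>+t\<in>{r..s}. ennreal (1 / t ^ n) \<partial>lborel) * weighted_energy n g g'"
proof -
  define \<phi> where "\<phi> = (\<lambda>t. ennreal (sqrt (1 / t ^ n)) * indicator {r..s} t)"
  define \<psi> where "\<psi> = (\<lambda>t. ennreal (sqrt (t ^ n) * \<bar>g' t\<bar>) * indicator {r..s} t)"
  have [measurable]: "\<phi> \<in> borel_measurable lborel" "\<psi> \<in> borel_measurable lborel"
    unfolding \<phi>_def \<psi>_def by measurable
  have \<phi>\<psi>: "\<phi> t * \<psi> t = ennreal \<bar>g' t\<bar> * indicator {r..s} t" for t
    using r by (auto simp: \<phi>_def \<psi>_def indicator_def real_sqrt_divide simp flip: ennreal_mult)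
  have \<phi>2: "\<phi> t ^ 2 = ennreal (1 / t ^ n) * indicator {r..s} t" for t
    using r by (auto simp: \<phi>_def indicator_def ennreal_power)
  have \<psi>2: "\<psi> t ^ 2 \<le> ennreal (t ^ n * ((g' t)\<^sup>2 + (g t)\<^sup>2)) * indicator {0..} t" for t
    using r by (auto simp: \<psi>_def indicator_def ennreal_power power_mult_distrib
        intro!: ennreal_leI mult_left_mono)
  have "ennreal ((g s - g r)\<^sup>2) = (ennreal \<bar>g s - g r\<bar>)\<^sup>2" by (simp add: ennreal_power)
  also have "\<dots> \<le> (\<integral>\<^sup>+t\<in>{r..s}. ennreal \<bar>g' t\<bar> \<partial>lborel)\<^sup>2"
    using r deriv cont_deriv
    by (intro power_mono_ennreal abs_diff_le_nn_integral_deriv)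
      (auto simp: continuous_on_eq_continuous_at)
  also have "\<dots> = (\<integral>\<^sup>+t. \<phi> t * \<psi> t \<partial>lborel)\<^sup>2" by (simp only: \<phi>\<psi>)
  also have "\<dots> \<le> (\<integral>\<^sup>+t. \<phi> t ^ 2 \<partial>lborel) * (\<integral>\<^sup>+t. \<psi> t ^ 2 \<partial>lborel)"
    by (rule Cauchy_Schwarz_nn_integral) measurable
  also have "\<dots> \<le> (\<integral>\<^sup>+t\<in>{r..s}. ennreal (1 / t ^ n) \<partial>lborel) * weighted_energy n g g'"
    unfolding weighted_energy_def \<phi>2 by (intro mult_left_mono nn_integral_mono \<psi>2) auto
  finally show ?thesis .
qed

lemma diff_power2_le_energy:
  assumes r: "0 < r" "r \<le> s"
  shows "ennreal ((g s - g r)\<^sup>2) \<le> ennreal ((s - r) / r ^ n) * weighted_energy n g g'"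
  using diff_power2_le_inverse_weight_energy[OF r] nn_integral_inverse_power_le[OF r]
  by (meson mult_right_mono order_trans zero_le)

lemma power_times_power2_le_energy:
  assumes vanish: "\<And>t. \<rho> \<le> t \<Longrightarrow> g t = 0" and r: "0 \<le> r"
  shows "ennreal (r ^ n * (g r)\<^sup>2) \<le> weighted_energy n g g'"
proof -
  have cont: "isCont g t" "isCont g' t" for t
    using deriv cont_deriv by (auto simp: continuous_on_eq_continuous_at intro: DERIV_isCont)
  have "ennreal ((g r)\<^sup>2) = ennreal \<bar>(g (max r \<rho>))\<^sup>2 - (g r)\<^sup>2\<bar>" by (simp add: vanish)
  also have "\<dots> \<le> (\<integral>\<^sup>+t\<in>{r..max r \<rho>}. ennreal \<bar>2 * g t * g' t\<bar> \<partial>lborel)"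
    by (rule abs_diff_le_nn_integral_deriv)
      (auto intro!: derivative_eq_intros deriv continuous_intros cont)
  also have "\<dots> \<le> (\<integral>\<^sup>+t\<in>{r..}. ennreal ((g' t)\<^sup>2 + (g t)\<^sup>2) \<partial>lborel)"
  proof (rule nn_integral_mono)
    have "\<bar>2 * x * y\<bar> \<le> y\<^sup>2 + x\<^sup>2" for x y :: real
      using sum_squares_bound[of "\<bar>x\<bar>" "\<bar>y\<bar>"] by (simp add: abs_mult)
    then show "ennreal \<bar>2 * g t * g' t\<bar> * indicator {r..max r \<rho>} t
      \<le> ennreal ((g' t)\<^sup>2 + (g t)\<^sup>2) * indicator {r..} t" for t
      by (auto simp: indicator_def simp del: ennreal_plus intro!: ennreal_leI)
  qed
  finally have "ennreal (r ^ n * (g r)\<^sup>2)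
      \<le> ennreal (r ^ n) * (\<integral>\<^sup>+t\<in>{r..}. ennreal ((g' t)\<^sup>2 + (g t)\<^sup>2) \<partial>lborel)"
    using r by (simp add: ennreal_mult mult_left_mono)
  also have "\<dots> = (\<integral>\<^sup>+t\<in>{r..}. ennreal (r ^ n * ((g' t)\<^sup>2 + (g t)\<^sup>2)) \<partial>lborel)"
  proof -
    have [measurable]: "g \<in> borel_measurable borel"
      using cont by (intro borel_measurable_continuous_onI) (simp add: continuous_on_eq_continuous_at)
    show ?thesis using r by (simp add: ennreal_mult mult.assoc nn_integral_cmult)
  qed
  also have "\<dots> \<le> weighted_energy n g g'"
    unfolding weighted_energy_def using r
    by (intro nn_integral_mono) (auto simp: indicator_def intro!: ennreal_leI mult_right_mono power_mono)
  finally show ?thesis .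
qed

lemma power2_le_powr_energy:
  assumes vanish: "\<And>t. \<rho> \<le> t \<Longrightarrow> g t = 0"
    and \<alpha>: "0 < \<alpha>" "real n - 1 \<le> 2 * \<alpha>" and r: "0 < r" "r \<le> 1"
  shows "ennreal ((g r)\<^sup>2) \<le> ennreal ((2 + 1 / \<alpha>) * r powr (- 2 * \<alpha>)) * weighted_energy n g g'"
proof -
  let ?E = "weighted_energy n g g'"
  have "ennreal ((g 1 - g r)\<^sup>2) \<le> ennreal (r powr (- 2 * \<alpha>) / (2 * \<alpha>)) * ?E"
    using diff_power2_le_inverse_weight_energy[OF r] nn_integral_inverse_power_le_powr[OF \<alpha> r]
    by (meson mult_right_mono order_trans zero_le)
  moreover have "ennreal ((g 1)\<^sup>2) \<le> ?E"
    using power_times_power2_le_energy[OF vanish, of \<rho> 1] by simp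
  moreover have "ennreal ((g r)\<^sup>2) \<le> 2 * ennreal ((g 1)\<^sup>2) + 2 * ennreal ((g 1 - g r)\<^sup>2)"
  proof (rule ennreal_le_double_sum)
    show "(g r)\<^sup>2 \<le> 2 * (g 1)\<^sup>2 + 2 * (g 1 - g r)\<^sup>2"
      using zero_le_power2[of "2 * g 1 - g r"] by (simp add: power2_eq_square algebra_simps)
  qed simp_all
  ultimately have "ennreal ((g r)\<^sup>2) \<le> 2 * ?E + 2 * (ennreal (r powr (- 2 * \<alpha>) / (2 * \<alpha>)) * ?E)"
    by (meson add_mono mult_left_mono order_trans zero_le)
  also have "\<dots> = ennreal (2 + r powr (- 2 * \<alpha>) / \<alpha>) * ?E"
    using \<alpha> by (simp add: distrib_right ennreal_mult' flip: mult.assoc ennreal_numeral ennreal_mult)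
  also have "\<dots> \<le> ennreal ((2 + 1 / \<alpha>) * r powr (- 2 * \<alpha>)) * ?E"
  proof (intro mult_right_mono ennreal_leI)
    have "1 \<le> r powr (- 2 * \<alpha>)" using r \<alpha> by (simp add: powr_minus one_le_inverse powr_le1)
    then show "2 + r powr (- 2 * \<alpha>) / \<alpha> \<le> (2 + 1 / \<alpha>) * r powr (- 2 * \<alpha>)" by (simp add: distrib_right)
  qed simp
  finally show ?thesis .
qed

lemma power2_le_envelope_energy:
  assumes vanish: "\<And>t. \<rho> \<le> t \<Longrightarrow> g t = 0"
    and \<alpha>: "0 < \<alpha>" "real n - 1 \<le> 2 * \<alpha>" and r: "0 < r"
  shows "ennreal ((g r)\<^sup>2) \<le> ennreal ((2 + 1 / \<alpha>) * (envelope n \<alpha> r)\<^sup>2) * weighted_energy n g g'"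
proof (cases "r \<le> 1")
  case True
  then show ?thesis using power2_le_powr_energy[OF vanish \<alpha> r] r by (simp add: envelope_power2)
next
  case False
  have "ennreal ((g r)\<^sup>2) = ennreal (1 / r ^ n) * ennreal (r ^ n * (g r)\<^sup>2)"
    using r by (simp flip: ennreal_mult)
  also have "\<dots> \<le> ennreal ((2 + 1 / \<alpha>) * (1 / r ^ n)) * weighted_energy n g g'"
    using r \<alpha> by (intro mult_mono ennreal_leI power_times_power2_le_energy[OF vanish])
      (auto intro!: divide_right_mono)
  finally show ?thesis using False r by (simp add: envelope_power2)
qed

end

section \<open>Spherical means\<close>

definition C1c :: "('a::euclidean_space \<Rightarrow> real) \<Rightarrow> bool" where
  "C1c f \<longleftrightarrow> (\<forall>x. f differentiable (at x)) \<and>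
     (\<forall>b\<in>Basis. continuous_on UNIV (\<lambda>x. frechet_derivative f (at x) b)) \<and> bounded {x. f x \<noteq> 0}"

lemma C0_inf_imp_C1c:
  assumes "f \<in> C0_inf"
  shows "C1c f"
proof -
  from assms have f: "smooth_fun f" and supp: "compact (closure {x. f x \<noteq> 0})"
    by (auto simp: C0_inf_def)
  have diff: "\<forall>x. g differentiable (at x)" if "smooth_fun g" for g :: "'a \<Rightarrow> real"
    using that by (cases rule: smooth_fun.cases) auto
  have "\<forall>b\<in>Basis. smooth_fun (\<lambda>x. frechet_derivative f (at x) b)"
    using f by (cases rule: smooth_fun.cases) auto
  then have "\<forall>b\<in>Basis. continuous_on UNIV (\<lambda>x. frechet_derivative f (at x) b)"
    using diff by (meson continuous_at_imp_continuous_on differentiable_imp_continuous_within)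
  moreover have "bounded {x. f x \<noteq> 0}"
    using compact_imp_bounded[OF supp] closure_subset by (rule bounded_subset)
  ultimately show ?thesis using diff[OF f] by (simp add: C1c_def)
qed

lemma C1c_has_derivative: "C1c f \<Longrightarrow> (f has_derivative frechet_derivative f (at x)) (at x)"
  by (simp add: C1c_def frechet_derivative_works)

lemma C1c_continuous: "C1c f \<Longrightarrow> continuous_on UNIV f"
  by (meson C1c_has_derivative continuous_at_imp_continuous_on has_derivative_continuous)

lemma C1c_borel_measurable: "C1c f \<Longrightarrow> f \<in> borel_measurable borel"
  by (simp add: C1c_continuous borel_measurable_continuous_onI)

lemma C1c_support:
  assumes "C1c f"
  obtains \<rho> where "\<And>x. \<rho> \<le> norm x \<Longrightarrow> f x = 0"
proof -
  obtain \<rho> where "\<And>x. f x \<noteq> 0 \<Longrightarrow> norm x < \<rho>"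
    using assms unfolding C1c_def bounded_pos_less by blast
  then show ?thesis using that by (metis not_le)
qed

lemma frechet_derivative_diff:
  assumes "C1c f" "C1c g"
  shows "frechet_derivative (\<lambda>x. f x - g x) (at x) =
    (\<lambda>v. frechet_derivative f (at x) v - frechet_derivative g (at x) v)"
  using C1c_has_derivative[OF assms(1), of x] C1c_has_derivative[OF assms(2), of x]
  by (intro frechet_derivative_at[symmetric] has_derivative_diff)

lemma C1c_diff:
  assumes "C1c f" "C1c g"
  shows "C1c (\<lambda>x. f x - g x)"
proof -
  have "bounded ({x. f x \<noteq> 0} \<union> {x. g x \<noteq> 0})" using assms by (simp add: C1c_def)
  then have "bounded {x. f x - g x \<noteq> 0}" by (rule bounded_subset) auto
  then show ?thesis
    using assms unfolding C1c_def frechet_derivative_diff[OF assms] by (auto intro!: continuous_on_diff)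
qed

lemma frechet_derivative_eq_sum:
  assumes "C1c f"
  shows "frechet_derivative f (at x) v = (\<Sum>b\<in>Basis. (v \<bullet> b) * frechet_derivative f (at x) b)"
proof -
  have lin: "linear (frechet_derivative f (at x))"
    using C1c_has_derivative[OF assms, of x] has_derivative_linear by blast
  have "frechet_derivative f (at x) v = frechet_derivative f (at x) (\<Sum>b\<in>Basis. (v \<bullet> b) *\<^sub>R b)"
    by (simp add: euclidean_representation)
  then show ?thesis by (simp add: linear_sum[OF lin] linear_cmul[OF lin])
qed

lemma grad_sq_nonneg: "0 \<le> grad_sq f x"
  by (simp add: grad_sq_def sum_nonneg)

lemma grad_sq_continuous: "C1c f \<Longrightarrow> continuous_on UNIV (grad_sq f)"
  unfolding grad_sq_def[abs_def] C1c_def by (intro continuous_on_sum continuous_on_power) blast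

lemma grad_sq_borel_measurable: "C1c f \<Longrightarrow> grad_sq f \<in> borel_measurable borel"
  by (simp add: grad_sq_continuous borel_measurable_continuous_onI)

lemma directional_derivative_power2_le:
  assumes "C1c f"
  shows "(frechet_derivative f (at x) v)\<^sup>2 \<le> (norm v)\<^sup>2 * grad_sq f x"
proof -
  have "(norm v)\<^sup>2 = (\<Sum>b\<in>Basis. (v \<bullet> b)\<^sup>2)"
    unfolding power2_norm_eq_inner euclidean_inner[of v v] by (simp only: power2_eq_square)
  then show ?thesis
    unfolding frechet_derivative_eq_sum[OF assms, of x v] grad_sq_def
    by (simp only: Cauchy_Schwarz_ineq_sum)
qed

lemma C1c_ray_derivative:
  assumes f: "C1c f"
  shows "((\<lambda>t. f (t *\<^sub>R v)) has_real_derivative frechet_derivative f (at (t *\<^sub>R v)) v) (at t)"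
proof -
  let ?D = "frechet_derivative f (at (t *\<^sub>R v))"
  have lin: "linear ?D" using C1c_has_derivative[OF f] has_derivative_linear by blast
  have "((\<lambda>t. t *\<^sub>R v) has_derivative (\<lambda>h. h *\<^sub>R v)) (at t)"
    by (auto intro!: derivative_eq_intros)
  from has_derivative_compose[OF this C1c_has_derivative[OF f]]
  have "((\<lambda>t. f (t *\<^sub>R v)) has_derivative (\<lambda>h. ?D (h *\<^sub>R v))) (at t)" .
  also have "(\<lambda>h. ?D (h *\<^sub>R v)) = (*) (?D v)"
    by (simp add: fun_eq_iff linear_cmul[OF lin])
  finally show ?thesis unfolding has_field_derivative_def .
qed

lemma C1c_ray_derivative_continuous:
  assumes f: "C1c f"
  shows "continuous_on UNIV (\<lambda>t. frechet_derivative f (at (t *\<^sub>R v)) v)"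
proof -
  have "continuous_on UNIV (\<lambda>x. \<Sum>b\<in>Basis. (v \<bullet> b) * frechet_derivative f (at x) b)"
    using f unfolding C1c_def by (intro continuous_on_sum continuous_on_mult continuous_on_const) blast
  then have "continuous_on UNIV (\<lambda>x. frechet_derivative f (at x) v)"
    by (simp only: frechet_derivative_eq_sum[OF f, of _ v])
  then show ?thesis
    by (rule continuous_on_compose2) (auto intro!: continuous_intros)
qed

definition ray_energy :: "('a::euclidean_space \<Rightarrow> real) \<Rightarrow> 'a \<Rightarrow> ennreal" where
  "ray_energy f \<omega> = weighted_energy (DIM('a) - 1)
     (\<lambda>t. f (t *\<^sub>R \<omega>)) (\<lambda>t. frechet_derivative f (at (t *\<^sub>R \<omega>)) \<omega>)"

lemma C1c_power2_le_ray_energy: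
  fixes f :: "'a::euclidean_space \<Rightarrow> real"
  assumes f: "C1c f" and \<omega>: "norm \<omega> = 1"
    and \<alpha>: "0 < \<alpha>" "real DIM('a) - 2 \<le> 2 * \<alpha>" and r: "0 < r"
  shows "ennreal ((f (r *\<^sub>R \<omega>))\<^sup>2)
    \<le> ennreal ((2 + 1 / \<alpha>) * (envelope (DIM('a) - 1) \<alpha> r)\<^sup>2) * ray_energy f \<omega>"
proof -
  obtain \<rho> where \<rho>: "\<And>x. \<rho> \<le> norm x \<Longrightarrow> f x = 0" using C1c_support[OF f] by blast
  have "f (t *\<^sub>R \<omega>) = 0" if "\<rho> \<le> t" for t using that \<omega> by (intro \<rho>) simp
  moreover have "real (DIM('a) - 1) - 1 \<le> 2 * \<alpha>" using \<alpha>(2) by (simp add: of_nat_diff)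
  ultimately show ?thesis
    unfolding ray_energy_def using \<alpha>(1) r
    by (intro power2_le_envelope_energy[where \<rho> = \<rho>]
        C1c_ray_derivative[OF f] C1c_ray_derivative_continuous[OF f])
qed

lemma C1c_diff_power2_le_ray_energy:
  fixes f :: "'a::euclidean_space \<Rightarrow> real"
  assumes f: "C1c f" and r: "0 < r" "r \<le> s"
  shows "ennreal ((f (s *\<^sub>R \<omega>) - f (r *\<^sub>R \<omega>))\<^sup>2)
    \<le> ennreal ((s - r) / r ^ (DIM('a) - 1)) * ray_energy f \<omega>"
  unfolding ray_energy_def
  by (rule diff_power2_le_energy[OF C1c_ray_derivative[OF f] C1c_ray_derivative_continuous[OF f] r])

lemma ray_energy_le:
  fixes f :: "'a::euclidean_space \<Rightarrow> real"
  assumes f: "C1c f" and \<omega>: "norm \<omega> = 1"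
  shows "ray_energy f \<omega> \<le> ennreal (1 / sphere_area TYPE('a)) *
      (\<integral>\<^sup>+t. ennreal (grad_sq f (t *\<^sub>R \<omega>) + (f (t *\<^sub>R \<omega>))\<^sup>2) \<partial>radial_measure TYPE('a))"
proof -
  note [measurable] = C1c_borel_measurable[OF f] grad_sq_borel_measurable[OF f]
  let ?h = "\<lambda>t. grad_sq f (t *\<^sub>R \<omega>) + (f (t *\<^sub>R \<omega>))\<^sup>2"
  let ?I = "\<integral>\<^sup>+t\<in>{0..}. ennreal (t ^ (DIM('a) - 1)) * ennreal (?h t) \<partial>lborel"
  have "ray_energy f \<omega> \<le> ?I"
    unfolding ray_energy_def weighted_energy_def
  proof (rule nn_integral_mono)
    fix t :: real
    let ?D = "frechet_derivative f (at (t *\<^sub>R \<omega>)) \<omega>"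
    have "?D\<^sup>2 \<le> grad_sq f (t *\<^sub>R \<omega>)"
      using directional_derivative_power2_le[OF f, of "t *\<^sub>R \<omega>" \<omega>] \<omega> by simp
    then have "ennreal (t ^ (DIM('a) - 1) * (?D\<^sup>2 + (f (t *\<^sub>R \<omega>))\<^sup>2)) \<le> ennreal (t ^ (DIM('a) - 1) * ?h t)"
      if "0 \<le> t"
      using that by (intro ennreal_leI mult_left_mono add_right_mono) auto
    then show "ennreal (t ^ (DIM('a) - 1) * (?D\<^sup>2 + (f (t *\<^sub>R \<omega>))\<^sup>2)) * indicator {0..} t
      \<le> ennreal (t ^ (DIM('a) - 1)) * ennreal (?h t) * indicator {0..} t"
      by (cases "0 \<le> t") (simp_all add: ennreal_mult' del: ennreal_plus)
  qed
  also have "?I = ennreal (1 / sphere_area TYPE('a)) * (\<integral>\<^sup>+t. ennreal (?h t) \<partial>radial_measure TYPE('a))"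
  proof -
    have "ennreal (1 / sphere_area TYPE('a)) * ennreal (sphere_area TYPE('a)) = 1"
      using sphere_area_pos[where 'a = 'a] by (simp flip: ennreal_mult)
    moreover have "(\<lambda>t. ennreal (?h t)) \<in> borel_measurable borel" by measurable
    ultimately show ?thesis
      by (simp only: nn_integral_radial_measure mult.assoc[symmetric] mult_1_left)
  qed
  finally show ?thesis .
qed

lemma sphere_nn_integral_le_H1_norm:
  fixes f :: "'a::euclidean_space \<Rightarrow> real"
  assumes f: "C1c f" and k: "0 \<le> k"
    and rays: "\<And>\<omega>. norm \<omega> = 1 \<Longrightarrow> X \<omega> \<le> ennreal k * ray_energy f \<omega>"
  shows "(\<integral>\<^sup>+\<omega>. X \<omega> \<partial>uniform_sphere) \<le> ennreal (k / sphere_area TYPE('a)) * normV_sq (\<lambda>_. 1) f"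
proof -
  note [measurable] = C1c_borel_measurable[OF f] grad_sq_borel_measurable[OF f]

  let ?c = "sphere_area TYPE('a)" and ?h = "\<lambda>x. ennreal (grad_sq f x + (f x)\<^sup>2)"
  let ?I = "\<lambda>\<omega>. \<integral>\<^sup>+t. ?h (t *\<^sub>R \<omega>) \<partial>radial_measure TYPE('a)"
  have const: "ennreal (k / ?c) = ennreal k * ennreal (1 / ?c)"
    using k sphere_area_pos[where 'a = 'a] by (simp flip: ennreal_mult)
  have "AE \<omega> in uniform_sphere. X \<omega> \<le> ennreal (k / ?c) * ?I \<omega>"
    using AE_uniform_sphere_norm
  proof eventually_elim
    case (elim \<omega>)
    note rays[OF elim]
    also note mult_left_mono[OF ray_energy_le[OF f elim], of "ennreal k"]
    finally show ?case unfolding const mult.assoc by simp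
  qed
  then have "(\<integral>\<^sup>+\<omega>. X \<omega> \<partial>uniform_sphere) \<le> (\<integral>\<^sup>+\<omega>. ennreal (k / ?c) * ?I \<omega> \<partial>uniform_sphere)"
    by (rule nn_integral_mono_AE)
  also have "\<dots> = ennreal (k / ?c) * (\<integral>\<^sup>+\<omega>. ?I \<omega> \<partial>uniform_sphere)"
    by (rule nn_integral_cmult) measurable
  also have "(\<integral>\<^sup>+\<omega>. ?I \<omega> \<partial>uniform_sphere) = (\<integral>\<^sup>+x. ?h x \<partial>lborel)"
    by (rule nn_integral_polar_rays[symmetric]) measurable
  finally show ?thesis unfolding normV_sq_def nn_integral_completion by simp
qed

definition sph_mean :: "('a::euclidean_space \<Rightarrow> real) \<Rightarrow> real \<Rightarrow> real" where
  "sph_mean f r = (\<integral>\<omega>. f (r *\<^sub>R \<omega>) \<partial>uniform_sphere)"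

lemma sph_mean_borel_measurable:
  assumes [measurable]: "f \<in> borel_measurable borel"
  shows "sph_mean f \<in> borel_measurable borel"
  unfolding sph_mean_def[abs_def] by measurable

lemma integrable_uniform_sphere:
  fixes f :: "'a::euclidean_space \<Rightarrow> real"
  assumes f: "continuous_on UNIV f"
  shows "integrable uniform_sphere (\<lambda>\<omega>. f (r *\<^sub>R \<omega>))"
proof -
  note [measurable] = borel_measurable_continuous_onI[OF f]
  have "bounded (f ` cball 0 \<bar>r\<bar>)"
    by (intro compact_imp_bounded compact_continuous_image continuous_on_subset[OF f]) auto
  then obtain K where "\<forall>y \<in> f ` cball 0 \<bar>r\<bar>. norm y \<le> K" unfolding bounded_iff by blast
  then have K: "\<bar>f x\<bar> \<le> K" if "norm x \<le> \<bar>r\<bar>" for x using that by simp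
  have "AE \<omega> in uniform_sphere. \<bar>f (r *\<^sub>R \<omega>)\<bar> \<le> K"
    using AE_uniform_sphere_norm by eventually_elim (simp add: K)
  then show ?thesis by (intro uniform_sphere.integrable_const_bound) simp_all
qed

lemma sph_mean_diff:
  fixes f g :: "'a::euclidean_space \<Rightarrow> real"
  assumes "continuous_on UNIV f" "continuous_on UNIV g"
  shows "sph_mean (\<lambda>x. f x - g x) r = sph_mean f r - sph_mean g r"
  unfolding sph_mean_def by (intro Bochner_Integration.integral_diff integrable_uniform_sphere assms)

lemma sphere_integral_power2_le_H1_norm:
  fixes f :: "'a::euclidean_space \<Rightarrow> real"
  assumes f: "C1c f" and X: "X \<in> borel_measurable uniform_sphere" and k: "0 \<le> k"
    and rays: "\<And>\<omega>. norm \<omega> = 1 \<Longrightarrow> ennreal ((X \<omega>)\<^sup>2) \<le> ennreal k * ray_energy f \<omega>"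
    and e: "normV_sq (\<lambda>_. 1) f \<le> ennreal e" "0 \<le> e"
  shows "(\<integral>\<omega>. X \<omega> \<partial>uniform_sphere)\<^sup>2 \<le> k / sphere_area TYPE('a) * e"
proof -
  have kc: "0 \<le> k / sphere_area TYPE('a)" using k sphere_area_pos[where 'a = 'a] by simp
  have "ennreal ((\<integral>\<omega>. X \<omega> \<partial>uniform_sphere)\<^sup>2) \<le> (\<integral>\<^sup>+\<omega>. ennreal ((X \<omega>)\<^sup>2) \<partial>uniform_sphere)"
    using X by (rule uniform_sphere.expectation_power2_le_nn_integral)
  also have "\<dots> \<le> ennreal (k / sphere_area TYPE('a)) * normV_sq (\<lambda>_. 1) f"
    using f k rays by (rule sphere_nn_integral_le_H1_norm)
  also have "\<dots> \<le> ennreal (k / sphere_area TYPE('a)) * ennreal e" using e(1) by (rule mult_left_mono) simp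
  also have "\<dots> = ennreal (k / sphere_area TYPE('a) * e)" using kc e(2) by (rule ennreal_mult[symmetric])
  finally show ?thesis using mult_nonneg_nonneg[OF kc e(2)] by simp
qed

lemma sph_mean_power2_le:
  assumes [measurable]: "f \<in> borel_measurable borel"
  shows "ennreal ((sph_mean f r)\<^sup>2) \<le> (\<integral>\<^sup>+\<omega>. ennreal ((f (r *\<^sub>R \<omega>))\<^sup>2) \<partial>uniform_sphere)"
  unfolding sph_mean_def by (rule uniform_sphere.expectation_power2_le_nn_integral) measurable

lemma sph_mean_L2_contraction:
  fixes f :: "'a::euclidean_space \<Rightarrow> real"
  assumes [measurable]: "f \<in> borel_measurable borel"
  shows "(\<integral>\<^sup>+x. ennreal ((sph_mean f (norm (x::'a)))\<^sup>2) \<partial>lborel) \<le> (\<integral>\<^sup>+x. ennreal ((f x)\<^sup>2) \<partial>lborel)"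
proof -
  note [measurable] = sph_mean_borel_measurable[OF assms]
  have "(\<integral>\<^sup>+x. ennreal ((sph_mean f (norm (x::'a)))\<^sup>2) \<partial>lborel)
      = (\<integral>\<^sup>+t. ennreal ((sph_mean f t)\<^sup>2) \<partial>radial_measure TYPE('a))"
    by (simp add: radial_measure_def nn_integral_distr)
  also have "\<dots> \<le> (\<integral>\<^sup>+t. \<integral>\<^sup>+\<omega>. ennreal ((f (t *\<^sub>R \<omega>))\<^sup>2) \<partial>uniform_sphere \<partial>radial_measure TYPE('a))"
    by (intro nn_integral_mono sph_mean_power2_le) simp
  also have "\<dots> = (\<integral>\<^sup>+x. ennreal ((f x)\<^sup>2) \<partial>lborel)"
    by (rule nn_integral_polar[symmetric]) measurable
  finally show ?thesis .
qed

definition radial_profiles :: "nat \<Rightarrow> real \<Rightarrow> real \<Rightarrow> (real \<Rightarrow> real) set" where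
  "radial_profiles n \<alpha> K = {U \<in> borel_measurable borel.
     (\<forall>r>0. (U r)\<^sup>2 \<le> K * (envelope n \<alpha> r)\<^sup>2) \<and> (\<forall>r>0. \<forall>s\<ge>r. (U s - U r)\<^sup>2 \<le> K * ((s - r) / r ^ n))}"

lemma sph_mean_in_radial_profiles:
  fixes f :: "'a::euclidean_space \<Rightarrow> real"
  assumes f: "C1c f" and \<alpha>: "0 < \<alpha>" "real DIM('a) - 2 \<le> 2 * \<alpha>"
    and e: "normV_sq (\<lambda>_. 1) f \<le> ennreal e" "0 \<le> e"
  shows "sph_mean f \<in> radial_profiles (DIM('a) - 1) \<alpha> ((2 + 1 / \<alpha>) / sphere_area TYPE('a) * e)"
proof -
  define n where "n = DIM('a) - 1"
  define c where "c = sphere_area TYPE('a)"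
  have c: "0 < c" unfolding c_def by (rule sphere_area_pos)
  note [measurable] = C1c_borel_measurable[OF f]
  note sphere_bound = sphere_integral_power2_le_H1_norm[OF f _ _ _ e, folded c_def]
  have "(sph_mean f r)\<^sup>2 \<le> (2 + 1 / \<alpha>) / c * e * (envelope n \<alpha> r)\<^sup>2" if r: "0 < r" for r
  proof -
    have "(sph_mean f r)\<^sup>2 \<le> (2 + 1 / \<alpha>) * (envelope n \<alpha> r)\<^sup>2 / c * e"
      unfolding sph_mean_def n_def using \<alpha>(1)
      by (intro sphere_bound C1c_power2_le_ray_energy[OF f _ \<alpha> r]) auto
    then show ?thesis by (simp add: mult_ac)
  qed
  moreover have "(sph_mean f s - sph_mean f r)\<^sup>2 \<le> (2 + 1 / \<alpha>) / c * e * ((s - r) / r ^ n)"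
    if r: "0 < r" "r \<le> s" for r s
  proof -
    have "(sph_mean f s - sph_mean f r)\<^sup>2 = (\<integral>\<omega>. f (s *\<^sub>R \<omega>) - f (r *\<^sub>R \<omega>) \<partial>uniform_sphere)\<^sup>2"
      by (simp add: sph_mean_def integrable_uniform_sphere C1c_continuous f)
    also have "\<dots> \<le> (s - r) / r ^ n / c * e"
      unfolding n_def using r by (intro sphere_bound C1c_diff_power2_le_ray_energy[OF f r]) auto
    also have "\<dots> = 1 * ((s - r) / r ^ n / c * e)" by simp
    also have "\<dots> \<le> (2 + 1 / \<alpha>) * ((s - r) / r ^ n / c * e)"
      using r \<alpha>(1) c e(2) by (intro mult_right_mono) auto
    finally show ?thesis by (simp add: mult_ac)
  qed
  ultimately show ?thesis
    by (simp add: radial_profiles_def sph_mean_borel_measurable n_def c_def)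
qed

section \<open>Radial profiles\<close>

lemma sph_mean_diff_radial:
  fixes f :: "'a::euclidean_space \<Rightarrow> real"
  assumes f: "continuous_on UNIV f" and [measurable]: "U \<in> borel_measurable borel" and t: "0 \<le> t"
  shows "sph_mean (\<lambda>x. f x - U (norm x)) t = sph_mean f t - U t"
proof -
  note [measurable] = borel_measurable_continuous_onI[OF f]
  have "AE \<omega> in uniform_sphere. f (t *\<^sub>R \<omega>) - U (norm (t *\<^sub>R \<omega>)) = f (t *\<^sub>R \<omega>) - U t"
    using AE_uniform_sphere_norm by eventually_elim (simp add: t)
  then have "sph_mean (\<lambda>x. f x - U (norm x)) t = (\<integral>\<omega>. f (t *\<^sub>R \<omega>) - U t \<partial>uniform_sphere)"
    unfolding sph_mean_def by (intro integral_cong_AE) measurable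
  also have "\<dots> = sph_mean f t - U t"
    using integrable_uniform_sphere[OF f, of t]
    by (simp add: sph_mean_def uniform_sphere.prob_space[simplified])
  finally show ?thesis .
qed

lemma AE_radial_eq_lim_sph_mean:
  fixes u :: "'a::euclidean_space \<Rightarrow> real"
  assumes f: "\<And>k. continuous_on UNIV (f k)" and u: "radial u" "u \<in> borel_measurable lebesgue"
    and L2: "(\<lambda>k. \<integral>\<^sup>+x. ennreal ((f k x - u x)\<^sup>2) \<partial>lebesgue) \<longlonglongrightarrow> 0"
    and lim: "\<And>r. 0 < r \<Longrightarrow> (\<lambda>k. sph_mean (f k) r) \<longlonglongrightarrow> U r"
    and [measurable]: "U \<in> borel_measurable borel"
  shows "AE x in lebesgue. u x = U (norm x)"
proof -
  note [measurable] = borel_measurable_continuous_onI[OF f]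
  note [measurable] = sph_mean_borel_measurable[OF borel_measurable_continuous_onI[OF f]]
  obtain U' where [measurable]: "U' \<in> borel_measurable borel"
    and u_eq: "AE x in lebesgue. u x = U' (norm x)"
    using radial_AE_eq_borel_profile[OF u] by blast
  have "(\<integral>\<^sup>+x. ennreal ((U (norm x) - U' (norm x))\<^sup>2) \<partial>(lborel :: 'a measure)) \<le> 0"
  proof (rule nn_integral_AE_LIMSEQ_le[OF _ _ _ L2])
    show "AE x::'a in lborel. (\<lambda>k. ennreal ((sph_mean (f k) (norm x) - U' (norm x))\<^sup>2))
        \<longlonglongrightarrow> ennreal ((U (norm x) - U' (norm x))\<^sup>2)"
      using AE_lborel_singleton[of 0]
      by eventually_elim (intro tendsto_ennrealI tendsto_power tendsto_diff lim tendsto_const, simp)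
    fix k
    have "(\<integral>\<^sup>+x. ennreal ((sph_mean (f k) (norm x) - U' (norm x))\<^sup>2) \<partial>(lborel :: 'a measure))
        = (\<integral>\<^sup>+x. ennreal ((sph_mean (\<lambda>x. f k x - U' (norm x)) (norm x))\<^sup>2) \<partial>(lborel :: 'a measure))"
      by (simp add: sph_mean_diff_radial f)
    also have "\<dots> \<le> (\<integral>\<^sup>+x. ennreal ((f k x - U' (norm x))\<^sup>2) \<partial>lborel)"
      by (rule sph_mean_L2_contraction) measurable
    also have "\<dots> = (\<integral>\<^sup>+x. ennreal ((f k x - U' (norm x))\<^sup>2) \<partial>lebesgue)"
      by (rule nn_integral_completion[symmetric])
    also have "\<dots> = (\<integral>\<^sup>+x. ennreal ((f k x - u x)\<^sup>2) \<partial>lebesgue)"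
      by (rule nn_integral_cong_AE) (use u_eq in eventually_elim, simp)
    finally show "(\<integral>\<^sup>+x. ennreal ((sph_mean (f k) (norm x) - U' (norm x))\<^sup>2) \<partial>(lborel :: 'a measure))
        \<le> (\<integral>\<^sup>+x. ennreal ((f k x - u x)\<^sup>2) \<partial>lebesgue)" .
  qed measurable
  then have "AE x in lborel. ennreal ((U (norm (x::'a)) - U' (norm x))\<^sup>2) = 0"
    by (subst nn_integral_0_iff_AE[symmetric]) auto
  then have "AE x in lebesgue. U (norm (x::'a)) = U' (norm x)"
    by (intro AE_completion) (auto elim: eventually_mono)
  with u_eq show ?thesis by eventually_elim simp
qed

lemma radial_profiles_LIMSEQ:
  assumes U: "\<And>k. U k \<in> radial_profiles n \<alpha> K"
    and lim: "\<And>r. 0 < r \<Longrightarrow> (\<lambda>k. U k r) \<longlonglongrightarrow> L r" and "L \<in> borel_measurable borel"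
  shows "L \<in> radial_profiles n \<alpha> K"
proof -
  have "(L r)\<^sup>2 \<le> K * (envelope n \<alpha> r)\<^sup>2" if "0 < r" for r
    using U that by (intro LIMSEQ_le_const2[OF tendsto_power[OF lim]]) (auto simp: radial_profiles_def)
  moreover have "(L s - L r)\<^sup>2 \<le> K * ((s - r) / r ^ n)" if "0 < r" "r \<le> s" for r s
    using U that
    by (intro LIMSEQ_le_const2[OF tendsto_power[OF tendsto_diff[OF lim lim]]])
      (auto simp: radial_profiles_def)
  ultimately show ?thesis using assms(3) by (simp add: radial_profiles_def)
qed

lemma C1c_normV_sq_integrand_measurable:
  assumes "C1c f" and [measurable]: "V \<in> borel_measurable borel"
  shows "(\<lambda>x. ennreal (grad_sq f x + V x * (f x)\<^sup>2)) \<in> borel_measurable lborel"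
proof -
  note [measurable] = C1c_borel_measurable[OF assms(1)] grad_sq_borel_measurable[OF assms(1)]
  show ?thesis by measurable
qed

lemma normV_sq_const_1_le:
  fixes f V :: "'a::euclidean_space \<Rightarrow> real"
  assumes f: "C1c f" and V: "V \<in> borel_measurable borel" "\<And>x. c0 \<le> V x" "0 < c0"
  shows "normV_sq (\<lambda>_. 1) f \<le> ennreal (max 1 (1 / c0)) * normV_sq V f"
proof -
  define \<kappa> where "\<kappa> = max 1 (1 / c0)"
  have \<kappa>: "1 \<le> \<kappa>" "1 \<le> \<kappa> * c0"
    using V(3) mult_right_mono[of "1 / c0" \<kappa> c0] by (auto simp: \<kappa>_def)
  have "grad_sq f x + 1 * (f x)\<^sup>2 \<le> \<kappa> * (grad_sq f x + V x * (f x)\<^sup>2)" for x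
  proof -
    have "1 \<le> \<kappa> * V x" using \<kappa> V(2)[of x] mult_left_mono[of c0 "V x" \<kappa>] by linarith
    then have "1 * (f x)\<^sup>2 \<le> \<kappa> * V x * (f x)\<^sup>2" by (rule mult_right_mono) simp
    moreover have "1 * grad_sq f x \<le> \<kappa> * grad_sq f x" using \<kappa>(1) grad_sq_nonneg by (rule mult_right_mono)
    ultimately show ?thesis by (simp add: algebra_simps)
  qed
  then have "normV_sq (\<lambda>_. 1) f \<le> (\<integral>\<^sup>+x. ennreal \<kappa> * ennreal (grad_sq f x + V x * (f x)\<^sup>2) \<partial>lborel)"
    unfolding normV_sq_def nn_integral_completion using \<kappa>(1)
    by (intro nn_integral_mono) (simp add: ennreal_leI flip: ennreal_mult')
  also have "\<dots> = ennreal \<kappa> * normV_sq V f"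
    unfolding normV_sq_def nn_integral_completion
    by (rule nn_integral_cmult[OF C1c_normV_sq_integrand_measurable[OF f V(1)]])
  finally show ?thesis unfolding \<kappa>_def .
qed

lemma H1V_approx_C1c: "H1V_approx V u f \<Longrightarrow> C1c (f k)"
  by (simp add: H1V_approx_def C0_inf_imp_C1c)

lemma H1V_approx_Cauchy:
  assumes "H1V_approx V u f" "0 < e"
  obtains K where "\<And>i j. K \<le> i \<Longrightarrow> K \<le> j \<Longrightarrow> normV_sq V (\<lambda>x. f i x - f j x) < ennreal e"
  using assms unfolding H1V_approx_def by blast

lemma H1V_approx_L2: "H1V_approx V u f \<Longrightarrow> (\<lambda>k. \<integral>\<^sup>+x. ennreal ((f k x - u x)\<^sup>2) \<partial>lebesgue) \<longlonglongrightarrow> 0"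
  by (simp add: H1V_approx_def)

definition profile_const :: "'a::euclidean_space itself \<Rightarrow> real \<Rightarrow> real \<Rightarrow> real" where
  "profile_const _ \<alpha> c0 = (2 + 1 / \<alpha>) / sphere_area TYPE('a) * max 1 (1 / c0)"

lemma profile_const_nonneg: "0 < \<alpha> \<Longrightarrow> 0 \<le> profile_const TYPE('a::euclidean_space) \<alpha> c0"
  using sphere_area_pos[where 'a = 'a] by (simp add: profile_const_def)

context
  fixes V :: "'a::euclidean_space \<Rightarrow> real" and c0 \<alpha> :: real
  assumes V: "V \<in> borel_measurable borel" "\<And>x. c0 \<le> V x" "0 < c0"
    and \<alpha>: "0 < \<alpha>" "real DIM('a) - 2 \<le> 2 * \<alpha>"
begin

lemma sph_mean_profile_of_normV:
  assumes f: "C1c f" and e: "normV_sq V f \<le> ennreal e" "0 \<le> e"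
  shows "sph_mean f \<in> radial_profiles (DIM('a) - 1) \<alpha> (profile_const TYPE('a) \<alpha> c0 * e)"
proof -
  have "normV_sq (\<lambda>_. 1) f \<le> ennreal (max 1 (1 / c0)) * ennreal e"
    using normV_sq_const_1_le[OF f V] e(1) by (rule order_trans[OF _ mult_left_mono]) simp
  also have "\<dots> = ennreal (max 1 (1 / c0) * e)" using e(2) by (intro ennreal_mult[symmetric]) auto
  finally show ?thesis
    using sph_mean_in_radial_profiles[OF f \<alpha>] e(2) by (simp add: profile_const_def mult.assoc)
qed

lemma H1V_approx_sph_mean_convergent:
  assumes app: "H1V_approx V u f" and r: "0 < r"
  shows "convergent (\<lambda>k. sph_mean (f k) r)"
proof (rule Cauchy_convergent, rule CauchyI)
  fix \<epsilon> :: real assume \<epsilon>: "0 < \<epsilon>"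
  define E where "E = profile_const TYPE('a) \<alpha> c0 * (envelope (DIM('a) - 1) \<alpha> r)\<^sup>2"
  have E: "0 \<le> E" using \<alpha>(1) by (simp add: E_def profile_const_nonneg)
  have "0 < \<epsilon>\<^sup>2 / (E + 1)" using \<epsilon> E by simp
  from H1V_approx_Cauchy[OF app this] obtain K where
    K: "\<And>i j. K \<le> i \<Longrightarrow> K \<le> j \<Longrightarrow> normV_sq V (\<lambda>x. f i x - f j x) < ennreal (\<epsilon>\<^sup>2 / (E + 1))" by blast
  have "norm (sph_mean (f i) r - sph_mean (f j) r) < \<epsilon>" if "K \<le> i" "K \<le> j" for i j
  proof -
    note f = H1V_approx_C1c[OF app]
    have "sph_mean (\<lambda>x. f i x - f j x)
        \<in> radial_profiles (DIM('a) - 1) \<alpha> (profile_const TYPE('a) \<alpha> c0 * (\<epsilon>\<^sup>2 / (E + 1)))"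
      using K[OF that] E by (intro sph_mean_profile_of_normV C1c_diff f) auto
    then have "(sph_mean (f i) r - sph_mean (f j) r)\<^sup>2 \<le> E * (\<epsilon>\<^sup>2 / (E + 1))"
      using r by (simp add: radial_profiles_def sph_mean_diff C1c_continuous f E_def mult_ac)
    also have "\<dots> < \<epsilon>\<^sup>2" using \<epsilon> E by (simp add: field_simps)
    finally have "(norm (sph_mean (f i) r - sph_mean (f j) r))\<^sup>2 < \<epsilon>\<^sup>2" by simp
    then show ?thesis by (rule power2_less_imp_less) (use \<epsilon> in simp)
  qed
  then show "\<exists>K. \<forall>i\<ge>K. \<forall>j\<ge>K. norm (sph_mean (f i) r - sph_mean (f j) r) < \<epsilon>" by blast
qed

lemma H1V_bounded_by_radial_profile:
  assumes u: "radial u" "H1V_bounded_by V M u"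
  obtains U where "U \<in> radial_profiles (DIM('a) - 1) \<alpha> (profile_const TYPE('a) \<alpha> c0 * M\<^sup>2)"
    "AE x in lebesgue. u x = U (norm x)"
proof -
  from u(2) obtain f where um: "u \<in> borel_measurable lebesgue" and app: "H1V_approx V u f"
    and M: "\<And>k. normV_sq V (f k) \<le> ennreal (M\<^sup>2)"
    unfolding H1V_bounded_by_def by blast
  note f = H1V_approx_C1c[OF app]
  define U where "U = (\<lambda>r. lim (\<lambda>k. sph_mean (f k) r))"
  note [measurable] = sph_mean_borel_measurable[OF C1c_borel_measurable[OF f]]
  have U: "U \<in> borel_measurable borel" unfolding U_def by measurable
  have lim: "(\<lambda>k. sph_mean (f k) r) \<longlonglongrightarrow> U r" if "0 < r" for r
    using H1V_approx_sph_mean_convergent[OF app that] by (simp add: U_def convergent_LIMSEQ_iff)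
  have "U \<in> radial_profiles (DIM('a) - 1) \<alpha> (profile_const TYPE('a) \<alpha> c0 * M\<^sup>2)"
    by (rule radial_profiles_LIMSEQ[OF sph_mean_profile_of_normV[OF f M] lim U]) simp_all
  moreover have "AE x in lebesgue. u x = U (norm x)"
    by (rule AE_radial_eq_lim_sph_mean[OF C1c_continuous[OF f] u(1) um H1V_approx_L2[OF app] lim U])
  ultimately show ?thesis by (rule that)
qed

end

lemma H1V_bounded_by_weighted_L2:
  fixes u V :: "'a::euclidean_space \<Rightarrow> real"
  assumes V[measurable]: "V \<in> borel_measurable borel" and "H1V_bounded_by V M u"
  shows "weighted_L2_sq V u \<le> ennreal (M\<^sup>2)"
proof -
  from assms(2) obtain f where [measurable]: "u \<in> borel_measurable lebesgue" and app: "H1V_approx V u f"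
    and M: "\<And>k. normV_sq V (f k) \<le> ennreal (M\<^sup>2)"
    unfolding H1V_bounded_by_def by blast
  have [measurable]: "f k \<in> borel_measurable lebesgue" "V \<in> borel_measurable lebesgue" for k
    using V C1c_borel_measurable[OF H1V_approx_C1c[OF app]] by (auto intro!: measurable_completion)
  obtain \<sigma> where "AE x in lebesgue. (\<lambda>k. (f (\<sigma> k) x - u x)\<^sup>2) \<longlonglongrightarrow> 0"
    by (rule nn_integral_tendsto_0_AE_subseq[OF _ _ H1V_approx_L2[OF app]]) auto
  then have "AE x in lebesgue. (\<lambda>k. f (\<sigma> k) x) \<longlonglongrightarrow> u x"
  proof eventually_elim
    case (elim x)
    then have "(\<lambda>k. f (\<sigma> k) x - u x) \<longlonglongrightarrow> 0"
      using tendsto_real_sqrt[of _ 0] by (auto simp: tendsto_rabs_zero_iff)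
    then show ?case by (rule LIM_zero_cancel)
  qed
  then show ?thesis
  proof (rule weighted_L2_sq_AE_LIMSEQ_le[rotated 2])
    show "weighted_L2_sq V (f (\<sigma> k)) \<le> ennreal (M\<^sup>2)" for k
      unfolding weighted_L2_sq_def
      by (rule order_trans[OF nn_integral_mono M[of "\<sigma> k", unfolded normV_sq_def]])
        (simp add: ennreal_leI grad_sq_nonneg)
  qed auto
qed

lemma normV_sq_finite:
  fixes f V :: "'a::euclidean_space \<Rightarrow> real"
  assumes f: "C1c f" and V: "continuous_on UNIV V"
  shows "normV_sq V f < \<infinity>"
proof -
  obtain \<rho> where \<rho>: "\<And>x. \<rho> \<le> norm x \<Longrightarrow> f x = 0" using C1c_support[OF f] by blast
  have "grad_sq f x + V x * (f x)\<^sup>2 = 0" if "\<rho> < norm x" for x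
  proof -
    have "(f has_derivative (\<lambda>_. 0)) (at x)"
      by (rule has_derivative_transform_within_open[where f = "\<lambda>_. 0" and s = "{x. \<rho> < norm x}"])
        (auto simp: that \<rho> intro!: open_Collect_less continuous_intros)
    from frechet_derivative_at[OF this, symmetric] show ?thesis
      using \<rho>[of x] that by (simp add: grad_sq_def)
  qed
  then have "(\<lambda>x. indicator (cball 0 \<rho>) x *\<^sub>R (grad_sq f x + V x * (f x)\<^sup>2))
      = (\<lambda>x. grad_sq f x + V x * (f x)\<^sup>2)"
    by (auto simp: indicator_def fun_eq_iff)
  moreover have "integrable lborel (\<lambda>x. indicator (cball 0 \<rho>) x *\<^sub>R (grad_sq f x + V x * (f x)\<^sup>2))"
  proof (rule borel_integrable_compact)
    have "continuous_on UNIV (\<lambda>x. grad_sq f x + V x * (f x)\<^sup>2)"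
      by (intro continuous_intros grad_sq_continuous[OF f] C1c_continuous[OF f] V)
    then show "continuous_on (cball 0 \<rho>) (\<lambda>x. grad_sq f x + V x * (f x)\<^sup>2)"
      by (rule continuous_on_subset) simp
  qed simp
  ultimately have "integrable lborel (\<lambda>x. grad_sq f x + V x * (f x)\<^sup>2)" by simp
  then show ?thesis
    unfolding normV_sq_def nn_integral_completion real_integrable_def by (simp add: less_top)
qed

lemma normV_sq_le_diff:
  fixes f g V :: "'a::euclidean_space \<Rightarrow> real"
  assumes f: "C1c f" and g: "C1c g" and V: "V \<in> borel_measurable borel" "\<And>x. 0 \<le> V x"
  shows "normV_sq V f \<le> 2 * normV_sq V (\<lambda>x. f x - g x) + 2 * normV_sq V g"
proof -
  let ?q = "\<lambda>h x. grad_sq h x + V x * (h x)\<^sup>2"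
  have sq: "a\<^sup>2 \<le> 2 * (a - b)\<^sup>2 + 2 * b\<^sup>2" for a b :: real
    using zero_le_power2[of "a - 2 * b"] by (simp add: power2_eq_square algebra_simps)
  have "grad_sq f x \<le> 2 * grad_sq (\<lambda>x. f x - g x) x + 2 * grad_sq g x" for x
    unfolding grad_sq_def frechet_derivative_diff[OF f g] sum_distrib_left sum.distrib[symmetric]
    by (intro sum_mono sq)
  moreover have "V x * (f x)\<^sup>2 \<le> V x * (2 * (f x - g x)\<^sup>2 + 2 * (g x)\<^sup>2)" for x
    using V(2) sq by (intro mult_left_mono)
  ultimately have "?q f x \<le> 2 * ?q (\<lambda>x. f x - g x) x + 2 * ?q g x" for x
    by (smt (verit) distrib_left mult.left_commute)
  moreover have "0 \<le> ?q h x" for h x using V(2) by (simp add: grad_sq_nonneg)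
  ultimately have "ennreal (?q f x) \<le> 2 * ennreal (?q (\<lambda>x. f x - g x) x) + 2 * ennreal (?q g x)" for x
    by (intro ennreal_le_double_sum)
  then have "normV_sq V f \<le> (\<integral>\<^sup>+x. 2 * ennreal (?q (\<lambda>x. f x - g x) x) + 2 * ennreal (?q g x) \<partial>lborel)"
    unfolding normV_sq_def nn_integral_completion by (rule nn_integral_mono)
  also have "\<dots> = 2 * normV_sq V (\<lambda>x. f x - g x) + 2 * normV_sq V g"
    unfolding normV_sq_def nn_integral_completion
    using C1c_normV_sq_integrand_measurable[OF C1c_diff[OF f g] V(1)]
      C1c_normV_sq_integrand_measurable[OF g V(1)]
    by (simp add: nn_integral_add nn_integral_cmult)
  finally show ?thesis .
qed

lemma H1V_imp_bounded:
  fixes u V :: "'a::euclidean_space \<Rightarrow> real"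
  assumes u: "u \<in> H1V V" and V: "continuous_on UNIV V" "\<And>x. 0 \<le> V x"
  obtains M where "H1V_bounded_by V M u"
proof -
  from u obtain f where um: "u \<in> borel_measurable lebesgue" and app: "H1V_approx V u f"
    by (auto simp: H1V_def)
  note f = H1V_approx_C1c[OF app]
  obtain K where K: "\<And>i j. K \<le> i \<Longrightarrow> K \<le> j \<Longrightarrow> normV_sq V (\<lambda>x. f i x - f j x) < ennreal 1"
    using H1V_approx_Cauchy[OF app zero_less_one] by blast
  define Q where "Q = enn2real (normV_sq V (f K))"
  have Q: "normV_sq V (f K) = ennreal Q" "0 \<le> Q"
    using normV_sq_finite[OF f V(1), of K] by (auto simp: Q_def)
  have "normV_sq V (f (k + K)) \<le> ennreal ((sqrt (2 + 2 * Q))\<^sup>2)" for k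
  proof -
    have "normV_sq V (f (k + K)) \<le> 2 * normV_sq V (\<lambda>x. f (k + K) x - f K x) + 2 * normV_sq V (f K)"
      using V by (intro normV_sq_le_diff f borel_measurable_continuous_onI)
    also have "\<dots> \<le> 2 * ennreal 1 + 2 * ennreal Q"
      using K[of "k + K" K] Q(1) by (intro add_mono mult_left_mono) auto
    also have "\<dots> = ennreal ((sqrt (2 + 2 * Q))\<^sup>2)" using Q(2) by (simp add: ennreal_mult')
    finally show ?thesis .
  qed
  moreover have "H1V_approx V u (\<lambda>k. f (k + K))"
    unfolding H1V_approx_def
  proof (intro conjI allI impI)
    show "f (k + K) \<in> C0_inf" for k using app by (simp add: H1V_approx_def)
    show "(\<lambda>k. \<integral>\<^sup>+x. ennreal ((f (k + K) x - u x)\<^sup>2) \<partial>lebesgue) \<longlonglongrightarrow> 0"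
      by (rule LIMSEQ_ignore_initial_segment[OF H1V_approx_L2[OF app]])
    show "\<exists>J. \<forall>i\<ge>J. \<forall>j\<ge>J. normV_sq V (\<lambda>x. f (i + K) x - f (j + K) x) < ennreal e" if "0 < e" for e
      using H1V_approx_Cauchy[OF app that] by (meson trans_le_add1)
  qed
  ultimately have "H1V_bounded_by V (sqrt (2 + 2 * Q)) u" unfolding H1V_bounded_by_def using um by blast
  then show ?thesis by (rule that)
qed

section \<open>Compactness\<close>

lemma equicontinuous_imp_pointwise_convergent_subseq:
  fixes f :: "nat \<Rightarrow> 'a::euclidean_space \<Rightarrow> 'b::{real_normed_vector,heine_borel}"
  assumes bdd: "\<And>x. x \<in> S \<Longrightarrow> bounded (range (\<lambda>k. f k x))"
    and equi: "\<And>x e. x \<in> S \<Longrightarrow> 0 < e \<Longrightarrow> \<exists>d>0. \<forall>k. \<forall>y\<in>S. dist y x < d \<longrightarrow> dist (f k y) (f k x) < e"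
  obtains \<sigma> where "strict_mono \<sigma>" "\<And>x. x \<in> S \<Longrightarrow> convergent (\<lambda>k. f (\<sigma> k) x)"
proof -
  obtain T where T: "countable T" "T \<subseteq> S" "S \<subseteq> closure T" using separable by blast
  have "\<forall>x\<in>S. \<exists>b>0. \<forall>k. norm (f k x) \<le> b" using bdd unfolding bounded_pos by blast
  then obtain b where b: "\<And>x. x \<in> S \<Longrightarrow> 0 < b x" "\<And>x k. x \<in> S \<Longrightarrow> norm (f k x) \<le> b x" by metis
  have "norm (f k x /\<^sub>R b x) \<le> 1" if "x \<in> T" for k x
  proof -
    have "x \<in> S" using that T(2) by blast
    then show ?thesis using b(1)[of x] b(2)[of x k] by (simp add: divide_simps)
  qed
  then obtain \<sigma> where \<sigma>: "strict_mono (\<sigma> :: nat \<Rightarrow> nat)"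
    and lim: "\<And>x. x \<in> T \<Longrightarrow> \<exists>l. (\<lambda>k. f (\<sigma> k) x /\<^sub>R b x) \<longlonglongrightarrow> l"
    using function_convergent_subsequence[OF T(1), of "\<lambda>k x. f k x /\<^sub>R b x" 1] by blast
  have Cauchy_T: "Cauchy (\<lambda>k. f (\<sigma> k) x)" if x: "x \<in> T" for x
  proof -
    obtain l where "(\<lambda>k. f (\<sigma> k) x /\<^sub>R b x) \<longlonglongrightarrow> l" using lim[OF x] by blast
    then have "(\<lambda>k. b x *\<^sub>R (f (\<sigma> k) x /\<^sub>R b x)) \<longlonglongrightarrow> b x *\<^sub>R l" by (intro tendsto_scaleR tendsto_const)
    moreover have "b x \<noteq> 0" using b(1) T(2) x by force
    ultimately show ?thesis by (simp add: LIMSEQ_imp_Cauchy)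
  qed
  have "convergent (\<lambda>k. f (\<sigma> k) x)" if x: "x \<in> S" for x
  proof (rule Cauchy_convergent, rule metric_CauchyI)
    fix e :: real assume "0 < e"
    then have e3: "0 < e / 3" by simp
    obtain d where "0 < d" and d: "\<And>k y. y \<in> S \<Longrightarrow> dist y x < d \<Longrightarrow> dist (f k y) (f k x) < e / 3"
      using equi[OF x e3] by blast
    then obtain y where y: "y \<in> T" "dist y x < d" using T(3) x by (meson closure_approachable subsetD)
    obtain K where K: "\<And>i j. K \<le> i \<Longrightarrow> K \<le> j \<Longrightarrow> dist (f (\<sigma> i) y) (f (\<sigma> j) y) < e / 3"
      using metric_CauchyD[OF Cauchy_T[OF y(1)] e3] by blast
    have near: "dist (f (\<sigma> i) y) (f (\<sigma> i) x) < e / 3" for i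
      using d[OF _ y(2)] y(1) T(2) by blast
    have "dist (f (\<sigma> i) x) (f (\<sigma> j) x) < e" if "K \<le> i" "K \<le> j" for i j
      using dist_triangle_third[OF _ K[OF that] near] near by (simp add: dist_commute)
    then show "\<exists>K. \<forall>i\<ge>K. \<forall>j\<ge>K. dist (f (\<sigma> i) x) (f (\<sigma> j) x) < e" by blast
  qed
  with \<sigma> show ?thesis by (rule that)
qed

lemma radial_profiles_convergent_subseq:
  fixes U :: "nat \<Rightarrow> real \<Rightarrow> real"
  assumes U: "\<And>k. U k \<in> radial_profiles n \<alpha> K" and K: "0 \<le> K"
  obtains \<sigma> where "strict_mono \<sigma>" "\<And>r. 0 < r \<Longrightarrow> convergent (\<lambda>k. U (\<sigma> k) r)"
proof (rule equicontinuous_imp_pointwise_convergent_subseq[of "{0<..}" U])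
  fix r :: real assume "r \<in> {0<..}"
  then have r: "0 < r" by simp
  have "\<bar>U k r\<bar> \<le> sqrt (K * (envelope n \<alpha> r)\<^sup>2)" for k
    using U[of k] r by (intro real_le_rsqrt) (simp add: radial_profiles_def)
  then show "bounded (range (\<lambda>k. U k r))" by (auto simp: bounded_iff)
  fix e :: real assume e: "0 < e"
  define L where "L = K / (r / 2) ^ n"
  have L: "0 \<le> L" using K r by (simp add: L_def)
  define d where "d = min (r / 2) (e\<^sup>2 / (L + 1))"
  have "\<bar>U k s - U k r\<bar> < e" if s: "0 < s" "dist s r < d" for k s
  proof -
    define a where "a = min r s"
    define b where "b = max r s"
    have "r / 2 < s" "\<bar>s - r\<bar> < e\<^sup>2 / (L + 1)"
      using s(2) unfolding d_def dist_real_def by linarith+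
    then have ab: "0 < a" "a \<le> b" "r / 2 \<le> a" "b - a < e\<^sup>2 / (L + 1)"
      using r s(1) by (auto simp: a_def b_def min_def max_def)
    have "(U k s - U k r)\<^sup>2 = (U k b - U k a)\<^sup>2" by (auto simp: a_def b_def min_def max_def power2_commute)
    also have "\<dots> \<le> K * ((b - a) / a ^ n)" using U[of k] ab by (simp add: radial_profiles_def)
    also have "\<dots> \<le> L * (b - a)"
    proof -
      have "K / a ^ n \<le> L" unfolding L_def using K r ab by (intro divide_left_mono power_mono) auto
      from mult_right_mono[OF this, of "b - a"] show ?thesis using ab(2) by simp
    qed
    also have "\<dots> \<le> L * (e\<^sup>2 / (L + 1))" using L ab by (intro mult_left_mono) auto
    also have "\<dots> < e\<^sup>2" using L e by (simp add: field_simps)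
    finally have "\<bar>U k s - U k r\<bar>\<^sup>2 < e\<^sup>2" by simp
    then show ?thesis by (rule power2_less_imp_less) (use e in simp)
  qed
  moreover have "0 < d" using r e L by (simp add: d_def)
  ultimately show "\<exists>d>0. \<forall>k. \<forall>s\<in>{0<..}. dist s r < d \<longrightarrow> dist (U k s) (U k r) < e"
    by (auto simp: dist_real_def)
qed (use that in auto)

lemma nn_integral_norm_powr_cball_finite:
  assumes a: "a < real DIM('a::euclidean_space)" and R: "0 \<le> R"
  shows "(\<integral>\<^sup>+x\<in>cball (0::'a) R. ennreal (norm x powr (- a)) \<partial>lborel) < \<infinity>"
proof -
  let ?p = "\<lambda>t::real. ennreal (t ^ (DIM('a) - 1))"
  define \<beta> where "\<beta> = real DIM('a) - 1 - a"
  have \<beta>: "-1 < \<beta>" using a by (simp add: \<beta>_def)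
  have "(\<integral>\<^sup>+x\<in>cball (0::'a) R. ennreal (norm x powr (- a)) \<partial>lborel)
      = (\<integral>\<^sup>+t. ennreal (t powr (- a)) * indicator {..R} t \<partial>radial_measure TYPE('a))"
    unfolding radial_measure_def
    by (subst nn_integral_distr) (auto intro!: nn_integral_cong simp: indicator_def)
  also have "\<dots> = ennreal (sphere_area TYPE('a)) *
      (\<integral>\<^sup>+t\<in>{0..}. ?p t * (ennreal (t powr (- a)) * indicator {..R} t) \<partial>lborel)"
    by (rule nn_integral_radial_measure) measurable
  also have "(\<integral>\<^sup>+t\<in>{0..}. ?p t * (ennreal (t powr (- a)) * indicator {..R} t) \<partial>lborel)
      = (\<integral>\<^sup>+t. ennreal (if t \<in> {0..R} then t powr \<beta> else 0) \<partial>lborel)"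
  proof (rule nn_integral_cong)
    fix t :: real
    have "t ^ (DIM('a) - 1) * t powr (- a) = t powr \<beta>" if "0 \<le> t"
    proof (cases "t = 0")
      case False
      then show ?thesis
        using that by (simp add: \<beta>_def of_nat_diff flip: powr_realpow powr_add)
    qed simp
    then show "?p t * (ennreal (t powr (- a)) * indicator {..R} t) * indicator {0..} t
        = ennreal (if t \<in> {0..R} then t powr \<beta> else 0)"
      by (auto simp: indicator_def simp flip: ennreal_mult)
  qed
  also have "\<dots> = ennreal (R powr (\<beta> + 1) / (\<beta> + 1))"
  proof (rule nn_integral_has_integral_lborel)
    show "((\<lambda>t. if t \<in> {0..R} then t powr \<beta> else 0) has_integral R powr (\<beta> + 1) / (\<beta> + 1)) UNIV"
      unfolding has_integral_restrict_UNIV by (rule has_integral_powr_from_0[OF \<beta> R])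
  qed auto
  finally show ?thesis by (simp add: ennreal_mult_less_top)
qed

lemma envelope_powr_le:
  assumes "0 < \<tau>"
  shows "envelope n \<alpha> t powr \<tau> \<le> 1 + t powr (- (\<alpha> * \<tau>))"
proof (cases "t \<le> 1")
  case True
  then show ?thesis by (simp add: envelope_def powr_powr)
next
  case False
  then have "t powr (- real n / 2) \<le> t powr 0" by (intro powr_mono) auto
  then have "envelope n \<alpha> t \<le> 1" using False by (simp add: envelope_def)
  then have "envelope n \<alpha> t powr \<tau> \<le> 1 powr \<tau>" using assms by (intro powr_mono2 envelope_nonneg) auto
  also have "\<dots> \<le> 1 + t powr (- (\<alpha> * \<tau>))" by simp
  finally show ?thesis .
qed

lemma envelope_cball_finite:
  fixes W :: "'a::euclidean_space \<Rightarrow> real"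
  assumes \<alpha>: "\<alpha> * \<tau> < real DIM('a)" "0 < \<tau>" and W: "continuous_on UNIV W" and A: "0 \<le> A" and R: "0 \<le> R"
  shows "(\<integral>\<^sup>+x\<in>cball 0 R. ennreal (W x * (A * envelope n \<alpha> (norm x)) powr \<tau>) \<partial>lebesgue) < \<infinity>"
proof -
  have "bounded (W ` cball 0 R)"
    by (intro compact_imp_bounded compact_continuous_image continuous_on_subset[OF W]) auto
  then obtain K where K: "0 < K" "\<forall>y\<in>W ` cball 0 R. norm y \<le> K" unfolding bounded_pos by blast
  have [measurable]: "cball (0::'a) R \<in> sets borel" by simp
  define D where "D = K * A powr \<tau>"
  have D: "0 \<le> D" using K(1) by (simp add: D_def)
  have "W x * (A * envelope n \<alpha> (norm x)) powr \<tau> \<le> D * (1 + norm x powr (- (\<alpha> * \<tau>)))" if "x \<in> cball 0 R" for x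
  proof -
    have "W x \<le> K" using K(2) that by (force simp: abs_le_iff)
    then have "W x * (A * envelope n \<alpha> (norm x)) powr \<tau> \<le> K * (A * envelope n \<alpha> (norm x)) powr \<tau>"
      by (rule mult_right_mono) simp
    also have "\<dots> = D * envelope n \<alpha> (norm x) powr \<tau>"
      using A by (simp add: D_def powr_mult envelope_nonneg)
    also have "\<dots> \<le> D * (1 + norm x powr (- (\<alpha> * \<tau>)))"
      using D by (intro mult_left_mono envelope_powr_le \<alpha>)
    finally show ?thesis .
  qed
  from ennreal_leI[OF this] have "ennreal (W x * (A * envelope n \<alpha> (norm x)) powr \<tau>)
      \<le> ennreal D * (1 + ennreal (norm x powr (- (\<alpha> * \<tau>))))" if "x \<in> cball 0 R" for x
    using that D by (simp add: ennreal_mult)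
  then have "(\<integral>\<^sup>+x\<in>cball 0 R. ennreal (W x * (A * envelope n \<alpha> (norm x)) powr \<tau>) \<partial>lborel)
      \<le> (\<integral>\<^sup>+x. ennreal D * (indicator (cball (0::'a) R) x
          + ennreal (norm x powr (- (\<alpha> * \<tau>))) * indicator (cball (0::'a) R) x) \<partial>lborel)"
    by (intro nn_integral_mono) (auto simp: indicator_def)
  also have "\<dots> = ennreal D * (\<integral>\<^sup>+x. indicator (cball (0::'a) R) x
          + ennreal (norm x powr (- (\<alpha> * \<tau>))) * indicator (cball (0::'a) R) x \<partial>lborel)"
    by (rule nn_integral_cmult) measurable
  also have "\<dots> = ennreal D * ((\<integral>\<^sup>+x. indicator (cball (0::'a) R) x \<partial>lborel)
        + (\<integral>\<^sup>+x\<in>cball (0::'a) R. ennreal (norm x powr (- (\<alpha> * \<tau>))) \<partial>lborel))"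
    by (rule arg_cong[OF nn_integral_add]) measurable
  also have "\<dots> < \<infinity>"
    using nn_integral_norm_powr_cball_finite[where 'a = 'a, OF \<alpha>(1) R]
      emeasure_lborel_cball_finite[of "0::'a" R]
    by (simp add: ennreal_mult_less_top)
  finally show ?thesis unfolding nn_integral_completion .
qed

lemma weighted_powr_le_of_decay:
  fixes w v W :: real
  assumes t: "1 \<le> t" and \<tau>: "\<tau>b \<le> \<tau>" and w: "\<bar>w\<bar> \<le> A * t powr (- real n / 2)"
    and nonneg: "2 \<le> \<tau>" "0 \<le> A" "0 \<le> C" "0 \<le> p" "0 \<le> v"
    and W: "W \<le> C * p * v * t powr (real n * (\<tau>b - 2) / 2)"
  shows "W * \<bar>w\<bar> powr \<tau> \<le> C * A powr (\<tau> - 2) * p * (v * w\<^sup>2)"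
proof -
  define T where "T = t powr (real n * (\<tau>b - 2) / 2)"
  have w_split: "\<bar>w\<bar> powr \<tau> = \<bar>w\<bar> powr (\<tau> - 2) * w\<^sup>2"
    by (cases "w = 0") (simp_all add: powr_diff)
  have "T * \<bar>w\<bar> powr (\<tau> - 2) \<le> T * (A * t powr (- real n / 2)) powr (\<tau> - 2)"
    unfolding T_def using w nonneg(1) by (intro mult_left_mono powr_mono2) auto
  also have "\<dots> = A powr (\<tau> - 2) * t powr (- (real n * (\<tau> - \<tau>b) / 2))"
  proof -
    have "real n * (\<tau>b - 2) / 2 + - real n / 2 * (\<tau> - 2) = - (real n * (\<tau> - \<tau>b) / 2)"
      by (simp add: field_simps)
    then have "T * t powr (- real n / 2 * (\<tau> - 2)) = t powr (- (real n * (\<tau> - \<tau>b) / 2))"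
      unfolding T_def powr_add[symmetric] by (rule arg_cong)
    then show ?thesis using nonneg(2) by (simp add: powr_mult powr_powr mult_ac)
  qed
  also have "\<dots> \<le> A powr (\<tau> - 2) * t powr 0"
    using t \<tau> by (intro mult_left_mono powr_mono) auto
  finally have decay: "T * \<bar>w\<bar> powr (\<tau> - 2) \<le> A powr (\<tau> - 2)" using t by simp
  have "W * \<bar>w\<bar> powr \<tau> \<le> C * p * v * T * \<bar>w\<bar> powr \<tau>"
    unfolding T_def using W by (rule mult_right_mono) simp
  also have "\<dots> = C * p * (v * w\<^sup>2) * (T * \<bar>w\<bar> powr (\<tau> - 2))" unfolding w_split by (simp add: mult_ac)
  also have "\<dots> \<le> C * p * (v * w\<^sup>2) * A powr (\<tau> - 2)" using nonneg decay by (intro mult_left_mono) auto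
  finally show ?thesis by (simp add: mult_ac)
qed

lemma AE_norm_pos: "AE x in lebesgue. 0 < norm (x::'a::euclidean_space)"
proof -
  have "AE x in lborel. 0 < norm (x::'a)"
    using AE_lborel_singleton[of "0::'a"] by eventually_elim simp
  then show ?thesis by (rule AE_completion)
qed

locale radial_embedding =
  fixes V W \<phi> :: "'a::euclidean_space \<Rightarrow> real" and \<tau>b R C c0 \<tau> \<alpha> :: real
  assumes contV: "continuous_on UNIV V" and contW: "continuous_on UNIV W"
    and V_ge: "\<And>x. c0 \<le> V x" and c0_pos: "0 < c0" and W_nonneg: "\<And>x. 0 \<le> W x"
    and \<phi>_nonneg: "\<And>x. 0 \<le> \<phi> x" and \<phi>_lim: "(\<phi> \<longlongrightarrow> 0) at_infinity"
    and \<tau>b_gt: "2 < \<tau>b" and \<tau>b_le: "\<tau>b \<le> \<tau>" and C_pos: "0 < C"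
    and W_le: "\<And>x. R \<le> norm x \<Longrightarrow> W x \<le> C * \<phi> x * V x * norm x powr ((real DIM('a) - 1) * (\<tau>b - 2) / 2)"
    and \<alpha>_pos: "0 < \<alpha>" and \<alpha>_ge: "real DIM('a) - 2 \<le> 2 * \<alpha>" and \<alpha>_less: "\<alpha> * \<tau> < real DIM('a)"
begin

abbreviation env :: "'a \<Rightarrow> real" where "env x \<equiv> envelope (DIM('a) - 1) \<alpha> (norm x)"

definition W_mass :: "'a set \<Rightarrow> ('a \<Rightarrow> real) \<Rightarrow> ennreal" where
  "W_mass S w = (\<integral>\<^sup>+x\<in>S. ennreal (W x * \<bar>w x\<bar> powr \<tau>) \<partial>lebesgue)"

definition admissible :: "real \<Rightarrow> real \<Rightarrow> ('a \<Rightarrow> real) \<Rightarrow> bool" where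
  "admissible A Q w \<longleftrightarrow> w \<in> borel_measurable lebesgue \<and> (AE x in lebesgue. \<bar>w x\<bar> \<le> A * env x) \<and>
     weighted_L2_sq V w \<le> ennreal Q"

lemma V_nonneg: "0 \<le> V x"
  using V_ge[of x] c0_pos by linarith

lemma V_borel_measurable: "V \<in> borel_measurable borel"
  using contV by (rule borel_measurable_continuous_onI)

lemma V_W_env_cball_measurable [measurable]:
  "V \<in> borel_measurable lebesgue" "W \<in> borel_measurable lebesgue" "env \<in> borel_measurable lebesgue"
  "cball (0::'a) r \<in> sets lebesgue"
  using V_borel_measurable borel_measurable_continuous_onI[OF contW]
  by (auto intro!: measurable_completion)

lemma admissible_measurable: "admissible A Q w \<Longrightarrow> w \<in> borel_measurable lebesgue"
  by (simp add: admissible_def)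

lemma admissible_diff:
  assumes "admissible A Q w" "admissible A Q v"
  shows "admissible (2 * A) (4 * Q) (\<lambda>x. w x - v x)"
  unfolding admissible_def
proof (intro conjI)
  note [measurable] = assms[THEN admissible_measurable]
  show "(\<lambda>x. w x - v x) \<in> borel_measurable lebesgue" by measurable
  have "AE x in lebesgue. \<bar>w x\<bar> \<le> A * env x" "AE x in lebesgue. \<bar>v x\<bar> \<le> A * env x"
    using assms by (simp_all add: admissible_def)
  then show "AE x in lebesgue. \<bar>w x - v x\<bar> \<le> 2 * A * env x"
    by eventually_elim linarith
  have "weighted_L2_sq V (\<lambda>x. w x - v x) \<le> 2 * weighted_L2_sq V w + 2 * weighted_L2_sq V v"
    by (rule weighted_L2_sq_diff_le) (simp_all add: V_nonneg)
  also have "\<dots> \<le> 2 * ennreal Q + 2 * ennreal Q"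
    using assms by (intro add_mono mult_left_mono) (auto simp: admissible_def)
  also have "\<dots> = ennreal (4 * Q)"
    by (simp add: ennreal_mult' flip: distrib_right)
  finally show "weighted_L2_sq V (\<lambda>x. w x - v x) \<le> ennreal (4 * Q)" .
qed

lemma admissible_LIMSEQ:
  assumes w: "\<And>k. admissible A Q (w k)" and lim: "AE x in lebesgue. (\<lambda>k. w k x) \<longlonglongrightarrow> v x"
    and v: "v \<in> borel_measurable lebesgue"
  shows "admissible A Q v"
  unfolding admissible_def
proof (intro conjI v)
  note [measurable] = w[THEN admissible_measurable]
  have "AE x in lebesgue. \<forall>k. \<bar>w k x\<bar> \<le> A * env x"
    using w by (simp add: AE_all_countable admissible_def)
  with lim show "AE x in lebesgue. \<bar>v x\<bar> \<le> A * env x"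
    by eventually_elim (rule LIMSEQ_le_const2[OF tendsto_rabs], auto)
  show "weighted_L2_sq V v \<le> ennreal Q"
    by (rule weighted_L2_sq_AE_LIMSEQ_le[OF _ _ lim]) (use w in \<open>auto simp: admissible_def\<close>)
qed

lemma W_powr_le_V_outside_cball:
  assumes A: "0 \<le> A" and \<delta>: "0 < \<delta>"
  obtains r where "0 \<le> r"
    "\<And>x w. r < norm x \<Longrightarrow> \<bar>w\<bar> \<le> A * env x \<Longrightarrow> W x * \<bar>w\<bar> powr \<tau> \<le> \<delta> * (V x * w\<^sup>2)"
proof -
  define D where "D = C * A powr (\<tau> - 2)"
  have D: "0 \<le> D" using C_pos by (simp add: D_def)
  have "\<forall>\<^sub>F x in at_infinity. dist (\<phi> x) 0 < \<delta> / (D + 1)" using \<delta> D by (intro tendstoD[OF \<phi>_lim]) simp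
  then obtain b where b: "\<And>x. b \<le> norm x \<Longrightarrow> \<phi> x < \<delta> / (D + 1)"
    unfolding eventually_at_infinity by (auto simp: \<phi>_nonneg)
  have "W x * \<bar>w\<bar> powr \<tau> \<le> \<delta> * (V x * w\<^sup>2)"
    if x: "max 1 (max b R) < norm x" and w: "\<bar>w\<bar> \<le> A * env x" for x w
  proof -
    have "W x * \<bar>w\<bar> powr \<tau> \<le> D * \<phi> x * (V x * w\<^sup>2)"
      unfolding D_def
    proof (rule weighted_powr_le_of_decay[where n = "DIM('a) - 1" and t = "norm x"])
      show "\<bar>w\<bar> \<le> A * norm x powr (- real (DIM('a) - 1) / 2)" using w x by (simp add: envelope_def)
      show "W x \<le> C * \<phi> x * V x * norm x powr (real (DIM('a) - 1) * (\<tau>b - 2) / 2)"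
        using W_le[of x] x by (simp add: of_nat_diff)
    qed (use x A C_pos \<tau>b_gt \<tau>b_le V_nonneg \<phi>_nonneg in auto)
    also have "\<dots> \<le> D * (\<delta> / (D + 1)) * (V x * w\<^sup>2)"
      using D b[of x] x V_nonneg[of x] by (intro mult_right_mono mult_left_mono) auto
    also have "\<dots> \<le> \<delta> * (V x * w\<^sup>2)"
      using D \<delta> V_nonneg[of x] by (intro mult_right_mono) (auto simp: field_simps)
    finally show ?thesis .
  qed
  then show ?thesis by (intro that[of "max 1 (max b R)"]) auto
qed

lemma admissible_W_mass_le_cball:
  assumes A: "0 \<le> A" and Q: "0 \<le> Q" and \<epsilon>: "0 < \<epsilon>"
  obtains r where "0 \<le> r" "\<And>w. admissible A Q w \<Longrightarrow> W_mass UNIV w \<le> W_mass (cball 0 r) w + ennreal \<epsilon>"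
proof -
  define \<delta> where "\<delta> = \<epsilon> / (Q + 1)"
  have \<delta>: "0 < \<delta>" "\<delta> * Q \<le> \<epsilon>" using \<epsilon> Q by (auto simp: \<delta>_def field_simps)
  obtain r where r: "0 \<le> r"
    "\<And>x w. r < norm x \<Longrightarrow> \<bar>w\<bar> \<le> A * env x \<Longrightarrow> W x * \<bar>w\<bar> powr \<tau> \<le> \<delta> * (V x * w\<^sup>2)"
    using W_powr_le_V_outside_cball[OF A \<delta>(1)] by blast
  have "W_mass UNIV w \<le> W_mass (cball 0 r) w + ennreal \<epsilon>" if w: "admissible A Q w" for w
  proof -
    note [measurable] = admissible_measurable[OF w]
    have "AE x in lebesgue. \<bar>w x\<bar> \<le> A * env x" using w by (simp add: admissible_def)
    then have "AE x in lebesgue. ennreal (W x * \<bar>w x\<bar> powr \<tau>)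
        \<le> ennreal (W x * \<bar>w x\<bar> powr \<tau>) * indicator (cball 0 r) x + ennreal \<delta> * ennreal (V x * (w x)\<^sup>2)"
    proof eventually_elim
      case (elim x)
      then show ?case
        using r(2)[of x "w x"] \<delta>(1) V_nonneg[of x]
        by (cases "x \<in> cball 0 r") (auto simp: ennreal_leI simp flip: ennreal_mult)
    qed
    then have "W_mass UNIV w \<le> (\<integral>\<^sup>+x. ennreal (W x * \<bar>w x\<bar> powr \<tau>) * indicator (cball 0 r) x
        + ennreal \<delta> * ennreal (V x * (w x)\<^sup>2) \<partial>lebesgue)"
      unfolding W_mass_def by (intro nn_integral_mono_AE) simp
    also have "\<dots> = W_mass (cball 0 r) w + ennreal \<delta> * weighted_L2_sq V w"
      by (simp add: W_mass_def weighted_L2_sq_def nn_integral_add nn_integral_cmult)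
    also have "\<dots> \<le> W_mass (cball 0 r) w + ennreal \<delta> * ennreal Q"
      using w by (intro add_left_mono mult_left_mono) (auto simp: admissible_def)
    also have "ennreal \<delta> * ennreal Q = ennreal (\<delta> * Q)"
      using \<delta>(1) Q by (intro ennreal_mult[symmetric]) auto
    also have "ennreal (\<delta> * Q) \<le> ennreal \<epsilon>" using \<delta>(2) by (rule ennreal_leI)
    finally show ?thesis by (simp add: add_left_mono)
  qed
  with r(1) show ?thesis by (rule that)
qed

lemma admissible_AE_le_envelope:
  assumes "admissible A Q w"
  shows "AE x in lebesgue. ennreal (W x * \<bar>w x\<bar> powr \<tau>) * indicator S x
    \<le> ennreal (W x * \<bar>A * env x\<bar> powr \<tau>) * indicator S x"
proof -
  have "AE x in lebesgue. \<bar>w x\<bar> \<le> A * env x" using assms by (simp add: admissible_def)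
  then show ?thesis
  proof eventually_elim
    case (elim x)
    then have "\<bar>w x\<bar> powr \<tau> \<le> \<bar>A * env x\<bar> powr \<tau>" using \<tau>b_gt \<tau>b_le by (intro powr_mono2) auto
    then show ?case using W_nonneg[of x] by (intro mult_right_mono ennreal_leI mult_left_mono) auto
  qed
qed

lemma W_mass_cball_envelope_finite:
  assumes "0 \<le> A" "0 \<le> r"
  shows "W_mass (cball 0 r) (\<lambda>x. A * env x) < \<infinity>"
  using envelope_cball_finite[OF \<alpha>_less _ contW assms] assms(1) \<tau>b_gt \<tau>b_le
  by (simp add: W_mass_def abs_mult envelope_nonneg)

lemma admissible_LW:
  assumes A: "0 \<le> A" and Q: "0 \<le> Q" and w: "admissible A Q w"
  shows "w \<in> LW W \<tau>"
proof -
  obtain r where r: "0 \<le> r"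
    and tail: "\<And>w. admissible A Q w \<Longrightarrow> W_mass UNIV w \<le> W_mass (cball 0 r) w + ennreal 1"
    using admissible_W_mass_le_cball[OF A Q, of 1] by auto
  note tail[OF w]
  also have "W_mass (cball 0 r) w + ennreal 1 \<le> W_mass (cball 0 r) (\<lambda>x. A * env x) + ennreal 1"
    unfolding W_mass_def by (intro add_right_mono nn_integral_mono_AE admissible_AE_le_envelope[OF w])
  also have "\<dots> < \<infinity>" using W_mass_cball_envelope_finite[OF A r] by simp
  finally show ?thesis using admissible_measurable[OF w] by (simp add: LW_def W_mass_def)
qed

lemma admissible_W_mass_cball_tendsto_0:
  assumes A: "0 \<le> A" and r: "0 \<le> r" and w: "\<And>k. admissible A Q (w k)"
    and lim: "AE x in lebesgue. (\<lambda>k. w k x) \<longlonglongrightarrow> 0"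
  shows "(\<lambda>k. W_mass (cball 0 r) (w k)) \<longlonglongrightarrow> 0"
proof -
  note [measurable] = admissible_measurable[OF w]
  have "(\<lambda>k. W_mass (cball 0 r) (w k)) \<longlonglongrightarrow> (\<integral>\<^sup>+(x::'a). 0 \<partial>lebesgue)"
    unfolding W_mass_def
  proof (rule nn_integral_dominated_convergence)
    show "(\<integral>\<^sup>+x\<in>cball 0 r. ennreal (W x * \<bar>A * env x\<bar> powr \<tau>) \<partial>lebesgue) < \<infinity>"
      using W_mass_cball_envelope_finite[OF A r] by (simp only: W_mass_def)
    show "AE x in lebesgue. (\<lambda>k. ennreal (W x * \<bar>w k x\<bar> powr \<tau>) * indicator (cball 0 r) x) \<longlonglongrightarrow> 0"
      using lim
    proof eventually_elim
      case (elim x)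
      have "(\<lambda>k. \<bar>w k x\<bar> powr \<tau>) \<longlonglongrightarrow> \<bar>0\<bar> powr \<tau>"
        using \<tau>b_gt \<tau>b_le by (intro tendsto_powr2 tendsto_rabs elim tendsto_const) auto
      then have "(\<lambda>k. ennreal (W x * \<bar>w k x\<bar> powr \<tau>)) \<longlonglongrightarrow> ennreal (W x * \<bar>0\<bar> powr \<tau>)"
        by (intro tendsto_ennrealI tendsto_mult_left)
      then show ?case by (cases "x \<in> cball 0 r") auto
    qed
    show "AE x in lebesgue. ennreal (W x * \<bar>w k x\<bar> powr \<tau>) * indicator (cball 0 r) x
        \<le> ennreal (W x * \<bar>A * env x\<bar> powr \<tau>) * indicator (cball 0 r) x" for k
      by (rule admissible_AE_le_envelope[OF w])
  qed measurable
  then show ?thesis by simp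
qed

lemma admissible_W_mass_tendsto_0:
  assumes A: "0 \<le> A" and Q: "0 \<le> Q" and w: "\<And>k. admissible A Q (w k)"
    and lim: "AE x in lebesgue. (\<lambda>k. w k x) \<longlonglongrightarrow> 0"
  shows "(\<lambda>k. W_mass UNIV (w k)) \<longlonglongrightarrow> 0"
proof (rule ennreal_tendsto_0I)
  fix e :: real assume e: "0 < e"
  obtain r where r: "0 \<le> r"
    and tail: "\<And>w. admissible A Q w \<Longrightarrow> W_mass UNIV w \<le> W_mass (cball 0 r) w + ennreal (e / 2)"
    using admissible_W_mass_le_cball[OF A Q, of "e / 2"] e by auto
  have "\<forall>\<^sub>F k in sequentially. W_mass (cball 0 r) (w k) < ennreal (e / 2)"
    using e by (intro order_tendstoD(2)[OF admissible_W_mass_cball_tendsto_0[OF A r w lim]]) simp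
  then show "\<forall>\<^sub>F k in sequentially. W_mass UNIV (w k) \<le> ennreal e"
  proof eventually_elim
    case (elim k)
    have "W_mass UNIV (w k) \<le> ennreal (e / 2) + ennreal (e / 2)"
      using tail[OF w[of k]] elim by (meson add_right_mono less_imp_le order_trans)
    also have "\<dots> = ennreal e" using e by (simp flip: ennreal_plus)
    finally show ?case .
  qed
qed

definition profile_bound :: "real \<Rightarrow> real" where
  "profile_bound M = profile_const TYPE('a) \<alpha> c0 * M\<^sup>2"

lemma profile_bound_nonneg: "0 \<le> profile_bound M"
  by (simp add: profile_bound_def profile_const_nonneg \<alpha>_pos)

lemmas radial_profile = H1V_bounded_by_radial_profile
  [OF V_borel_measurable V_ge c0_pos \<alpha>_pos \<alpha>_ge, folded profile_bound_def]

lemma radial_H1V_bounded_admissible: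
  assumes u: "radial u" "H1V_bounded_by V M u"
  shows "admissible (sqrt (profile_bound M)) (M\<^sup>2) u"
proof -
  obtain U where U: "U \<in> radial_profiles (DIM('a) - 1) \<alpha> (profile_bound M)"
    and u_eq: "AE x in lebesgue. u x = U (norm x)"
    by (rule radial_profile[OF u])
  have "\<bar>U r\<bar> \<le> sqrt (profile_bound M) * envelope (DIM('a) - 1) \<alpha> r" if "0 < r" for r
  proof -
    have "(U r)\<^sup>2 \<le> profile_bound M * (envelope (DIM('a) - 1) \<alpha> r)\<^sup>2"
      using U that by (simp add: radial_profiles_def)
    from real_sqrt_le_mono[OF this] show ?thesis
      by (simp add: real_sqrt_mult envelope_nonneg)
  qed
  then have "AE x in lebesgue. \<bar>u x\<bar> \<le> sqrt (profile_bound M) * env x"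
    using u_eq AE_norm_pos by (auto elim: eventually_elim2)
  then show ?thesis
    using u(2) H1V_bounded_by_weighted_L2[OF V_borel_measurable u(2)]
    by (simp add: admissible_def H1V_bounded_by_def)
qed

lemma H1V_rad_subset_LW_rad: "H1V_rad V \<subseteq> LW_rad W \<tau>"
proof
  fix u assume "u \<in> H1V_rad V"
  then have u: "u \<in> H1V V" "radial u" by (simp_all add: H1V_rad_def)
  obtain M where "H1V_bounded_by V M u" using H1V_imp_bounded[OF u(1) contV V_nonneg] .
  then have "u \<in> LW W \<tau>"
    by (intro admissible_LW[OF _ _ radial_H1V_bounded_admissible[OF u(2)]])
      (auto simp: profile_bound_nonneg)
  with u(2) show "u \<in> LW_rad W \<tau>" by (simp add: LW_rad_def)
qed

lemma bounded_radial_AE_convergent_subseq: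
  fixes u :: "nat \<Rightarrow> 'a \<Rightarrow> real"
  assumes u: "\<And>k. radial (u k)" "\<And>k. H1V_bounded_by V M (u k)"
  obtains \<sigma> v where "strict_mono \<sigma>" "radial v" "v \<in> borel_measurable lebesgue"
    "AE x in lebesgue. (\<lambda>k. u (\<sigma> k) x) \<longlonglongrightarrow> v x"
proof -
  have "\<exists>U \<in> radial_profiles (DIM('a) - 1) \<alpha> (profile_bound M).
      AE x in lebesgue. u k x = U (norm x)" for k
    using radial_profile[OF u] by blast
  then obtain U where U: "\<And>k. U k \<in> radial_profiles (DIM('a) - 1) \<alpha> (profile_bound M)"
    and u_eq: "\<And>k. AE x in lebesgue. u k x = U k (norm x)" by metis
  obtain \<sigma> :: "nat \<Rightarrow> nat" where \<sigma>: "strict_mono \<sigma>" and conv: "\<And>r. 0 < r \<Longrightarrow> convergent (\<lambda>k. U (\<sigma> k) r)"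
    using radial_profiles_convergent_subseq[of U, OF U profile_bound_nonneg] by metis
  define v where "v = (\<lambda>x::'a. lim (\<lambda>k. U (\<sigma> k) (norm x)))"
  have [measurable]: "U k \<in> borel_measurable borel" for k using U by (simp add: radial_profiles_def)
  have "v \<in> borel_measurable lebesgue" unfolding v_def by (intro measurable_completion) measurable
  moreover have "radial v" by (simp add: v_def radial_def)
  moreover have "AE x in lebesgue. \<forall>k. u k x = U k (norm x)" using u_eq by (simp add: AE_all_countable)
  then have "AE x in lebesgue. (\<lambda>k. u (\<sigma> k) x) \<longlonglongrightarrow> v x"
    using AE_norm_pos by eventually_elim (simp add: v_def conv flip: convergent_LIMSEQ_iff)
  ultimately show ?thesis using \<sigma> that by blast
qed

lemma compact_embedding: "compact_embedding_rad V W \<tau>"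
  unfolding compact_embedding_rad_def
proof (intro conjI allI impI)
  show "H1V_rad V \<subseteq> LW_rad W \<tau>" by (rule H1V_rad_subset_LW_rad)
  fix u :: "nat \<Rightarrow> 'a \<Rightarrow> real" and M
  assume "\<forall>k. u k \<in> H1V_rad V \<and> H1V_bounded_by V M (u k)"
  then have u: "radial (u k)" "H1V_bounded_by V M (u k)" for k by (simp_all add: H1V_rad_def)
  obtain \<sigma> v where \<sigma>: "strict_mono \<sigma>" and v: "radial v" "v \<in> borel_measurable lebesgue"
    and lim: "AE x in lebesgue. (\<lambda>k. u (\<sigma> k) x) \<longlonglongrightarrow> v x"
    by (rule bounded_radial_AE_convergent_subseq[OF u])
  have adm_u: "admissible (sqrt (profile_bound M)) (M\<^sup>2) (u k)" for k
    by (rule radial_H1V_bounded_admissible[OF u])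
  then have adm_v: "admissible (sqrt (profile_bound M)) (M\<^sup>2) v"
    using lim v(2) by (rule admissible_LIMSEQ)
  have "v \<in> LW_rad W \<tau>"
    using admissible_LW[OF _ _ adm_v] v(1) by (simp add: LW_rad_def profile_bound_nonneg)
  moreover have "(\<lambda>k. W_mass UNIV (\<lambda>x. u (\<sigma> k) x - v x)) \<longlonglongrightarrow> 0"
  proof (rule admissible_W_mass_tendsto_0)
    show "admissible (2 * sqrt (profile_bound M)) (4 * M\<^sup>2) (\<lambda>x. u (\<sigma> k) x - v x)" for k
      by (rule admissible_diff[OF adm_u adm_v])
    show "AE x in lebesgue. (\<lambda>k. u (\<sigma> k) x - v x) \<longlonglongrightarrow> 0"
      using lim by eventually_elim (rule LIM_zero)
  qed (simp_all add: profile_bound_nonneg)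
  ultimately show "\<exists>\<sigma> v. strict_mono \<sigma> \<and> v \<in> LW_rad W \<tau> \<and>
      (\<lambda>k. \<integral>\<^sup>+x. ennreal (W x * \<bar>u (\<sigma> k) x - v x\<bar> powr \<tau>) \<partial>lebesgue) \<longlonglongrightarrow> 0"
    using \<sigma> by (auto simp: W_mass_def)
qed

end

lemma subcritical_exponent:
  fixes N \<tau> :: real
  assumes N: "2 \<le> N" and \<tau>: "0 < \<tau>" "N = 2 \<or> \<tau> < 2 * N / (N - 2)"
  obtains \<alpha> where "0 < \<alpha>" "N - 2 \<le> 2 * \<alpha>" "\<alpha> * \<tau> < N"
proof -
  have "(N - 2) / 2 < N / \<tau>"
  proof (cases "N = 2")
    case False
    then show ?thesis using N \<tau> by (simp add: field_simps)
  qed (use \<tau> in simp)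
  then obtain \<alpha> where "(N - 2) / 2 < \<alpha>" "\<alpha> < N / \<tau>" using dense by blast
  then show ?thesis using N \<tau>(1) by (intro that[of \<alpha>]) (auto simp: field_simps)
qed

theorem theorem2p13:
  fixes V W \<phi> :: "'a::euclidean_space \<Rightarrow> real"
    and \<tau>bar R C :: real
  assumes "DIM('a) \<ge> 2"
    and "continuous_on UNIV V" and "continuous_on UNIV W"
    and "\<exists>c>0. \<forall>x. c \<le> V x" and "\<exists>c>0. \<forall>x. c \<le> W x"
    and "\<forall>x. 0 \<le> \<phi> x" and "(\<phi> \<longlongrightarrow> 0) at_infinity"
    and "\<tau>bar > 2" and "R > 0" and "C > 0"
    and "\<forall>x. norm x \<ge> R \<longrightarrow>
           W x \<le> C * \<phi> x * V x * norm x powr ((real DIM('a) - 1) * (\<tau>bar - 2) / 2)"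
  shows "\<forall>\<tau>. \<tau>bar \<le> \<tau> \<and> (DIM('a) = 2 \<or> \<tau> < 2 * real DIM('a) / (real DIM('a) - 2))
           \<longrightarrow> compact_embedding_rad V W \<tau>"
proof (intro allI impI)
  fix \<tau> assume \<tau>: "\<tau>bar \<le> \<tau> \<and> (DIM('a) = 2 \<or> \<tau> < 2 * real DIM('a) / (real DIM('a) - 2))"
  then obtain \<alpha> where \<alpha>: "0 < \<alpha>" "real DIM('a) - 2 \<le> 2 * \<alpha>" "\<alpha> * \<tau> < real DIM('a)"
    using subcritical_exponent[of "real DIM('a)" \<tau>] assms(1,8) by auto
  obtain c0 where c0: "0 < c0" "\<And>x. c0 \<le> V x" using assms(4) by blast
  have W: "0 \<le> W x" for x using assms(5) by (meson less_imp_le order_trans)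
  interpret radial_embedding V W \<phi> \<tau>bar R C c0 \<tau> \<alpha>
    by standard (use assms c0 W \<tau> \<alpha> in auto)
  show "compact_embedding_rad V W \<tau>" by (rule compact_embedding)
qed

end
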